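(* Let $\sigma>0$, $P=\mathcal N(0,\sigma^2)$ and, for $k>0$, $J^\star(k)=\inf_{Q\in\mathcal P_2(\mathbb R)}\{k^2W_2^2(P,Q)+\operatorname{mmse}(Q)\}$, with minimizer $Q_k^\star$. (a) As $k\to\infty$, $J^\star(k)\uparrow\operatorname{mmse}(P)=\frac{\sigma^2}{1+\sigma^2}$, and the minimizer obeys $W_2^2(P,Q_k^\star)=O(k^{-2})$, so $Q_k^\star\to P$ and the first controller $f_k^\star=F_{Q_k^\star}^{-1}\circ F_P$ tends to the identity. Within the Gaussian class $\{\mathcal N(0,\tau^2):\tau>0\}$ the minimizer of $k^2W_2^2(P,Q)+\operatorname{mmse}(Q)$ is unique for $k^2>\tfrac14$, with $\tau^\star=\sigma-O(k^{-2})$, and $\operatorname{mmse}(P)-J^\star(k)=\Theta(k^{-2})$ as $k\to\infty$. (b) As $k\to0$, $J^\star(k)\to0$; more precisely $J^\star(k)=O\bigl(k^2\log(1/k)\bigr)$, a bound attained (up to the constant) by the symmetric two-level law $Q_M=\tfrac12(\delta_{-M}+\delta_M)$ with $M=M(k)=4\sqrt{\log(1/k)}\to\infty$, i.e. $k^2W_2^2(P,Q_M)+\operatorname{mmse}(Q_M)=O\bigl(k^2\log(1/k)\bigr)$.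
   Context: $\mathcal P_2(\mathbb R)$ is the set of Borel probability measures on $\mathbb R$ with finite second moment. $W_2^2(P,Q)=\inf_\pi\int(x-y)^2\,\pi(dx,dy)$ over couplings $\pi$ of $P,Q$; convergence $Q_k^\star\to P$ is in $W_2$, and convergence of the first controller to the identity is in $L^2(P)$. $\operatorname{mmse}(Q)=\mathbb E[\operatorname{Var}(Y\mid Y+N)]$ for independent $Y\sim Q$, $N\sim\mathcal N(0,1)$. $F_\mu$ is the CDF of $\mu$ and $F_\mu^{-1}$ its quantile function. The symbol $\uparrow$ means monotone nondecreasing convergence in $k$. Asymptotic constants may depend on $\sigma$. *)

theory Defs
  imports "HOL-Probability.Probability" "HOL-Library.Landau_Symbols"
begin

definition P2 :: "real measure set" where
  "P2 = {Q. real_distribution Q \<and> integrable Q (\<lambda>x. x\<^sup>2)}"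

definition couplings :: "real measure \<Rightarrow> real measure \<Rightarrow> (real \<times> real) measure set" where
  "couplings P Q = {\<pi>. sets \<pi> = sets (borel \<Otimes>\<^sub>M borel) \<and>
                        distr \<pi> borel fst = P \<and> distr \<pi> borel snd = Q}"

(* Meant for P, Q in P2: then the cost is integrable under every coupling, so the Bochner
   integral is the true transport cost and the infimum is over a nonempty set bounded below. *)
definition W2_sq :: "real measure \<Rightarrow> real measure \<Rightarrow> real" where
  "W2_sq P Q = (INF \<pi>\<in>couplings P Q. \<integral>z. (fst z - snd z)\<^sup>2 \<partial>\<pi>)"

definition W2 :: "real measure \<Rightarrow> real measure \<Rightarrow> real" where
  "W2 P Q = sqrt (W2_sq P Q)"

(* The second parameter is the standard deviation, as in the library's normal_density:
   gaussian \<tau> is the law N(0, \<tau>^2). *)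
definition gaussian :: "real \<Rightarrow> real measure" where
  "gaussian \<tau> = density lborel (\<lambda>x. ennreal (normal_density 0 \<tau> x))"

definition cond_variance :: "'a measure \<Rightarrow> 'a measure \<Rightarrow> ('a \<Rightarrow> real) \<Rightarrow> 'a \<Rightarrow> real" where
  "cond_variance M F Y = real_cond_exp M F (\<lambda>\<omega>. (Y \<omega> - real_cond_exp M F Y \<omega>)\<^sup>2)"

(* (Y, N) is realised as the pair of coordinates on the product space Q x N(0,1);
   the conditioning is on the sigma-algebra generated by Y + N. *)
definition mmse :: "real measure \<Rightarrow> real" where
  "mmse Q =
     (let M = Q \<Otimes>\<^sub>M gaussian 1;
          F = vimage_algebra (space M) (\<lambda>\<omega>. fst \<omega> + snd \<omega>) borel
      in \<integral>\<omega>. cond_variance M F fst \<omega> \<partial>M)"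

definition cost :: "real measure \<Rightarrow> real \<Rightarrow> real measure \<Rightarrow> real" where
  "cost P k Q = k\<^sup>2 * W2_sq P Q + mmse Q"

definition J_star :: "real measure \<Rightarrow> real \<Rightarrow> real" where
  "J_star P k = (INF Q\<in>P2. cost P k Q)"

(* Used for u in the open interval (0,1) only. *)
definition quantile :: "real measure \<Rightarrow> real \<Rightarrow> real" where
  "quantile Q u = Inf {x. u \<le> cdf Q x}"

definition controller :: "real measure \<Rightarrow> real measure \<Rightarrow> real \<Rightarrow> real" where
  "controller P Q = quantile Q \<circ> cdf P"

(* The law (\<delta>_{-M} + \<delta>_M) / 2, as a measure on the Borel sets. *)
definition two_level :: "real \<Rightarrow> real measure" where
  "two_level M = distr (measure_pmf (pmf_of_set {-M, M})) borel (\<lambda>x. x)"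

end

theory Submission
  imports Defs "HOL-Real_Asymp.Real_Asymp"
begin

text \<open>
  Disintegrating along the observation \<open>z = y + n\<close> gives
  \<open>mmse Q = \<integral> v\<^sub>Q z dz\<close> with \<open>v\<^sub>Q z = \<integral> (y - E[Y | z])\<^sup>2 \<phi> (z - y) dQ \<ge> 0\<close>, and \<open>v\<^sub>Q z\<close> is a
  continuous function of integrals against \<open>Q\<close> of bounded continuous functions. By Fatou's lemma
  mmse is lower semicontinuous under weak convergence; so is the transport cost, written through
  distribution functions. Hence minimizers exist, by tightness and Helly selection.

  For the rate at infinity, the posterior mean for \<open>Q\<close> is used as an estimator under \<open>P\<close>. It grows
  at most linearly, so shifting the input from \<open>y\<close> to \<open>x\<close> changes its error by
  \<open>O ((1 + |x|)\<^sup>2 |x - y|)\<close>, where only moments of the Gaussian \<open>P\<close> are involved. Splitting this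
  product against \<open>k\<^sup>2 (x - y)\<^sup>2\<close> yields \<open>mmse P \<le> k\<^sup>2 W\<^sub>2\<^sup>2 (P, Q) + mmse Q + O (1 / k\<^sup>2)\<close>. The matching
  lower bound on the gap comes from \<open>N (0, (\<sigma> - c / k\<^sup>2)\<^sup>2)\<close>, and part (b) from the sign detector for
  the two-level law.
\<close>

subsection \<open>Minimum mean-square error\<close>

text \<open>Conditional expectations are fixed only almost everywhere, on a product space that
  changes with \<open>Q\<close>. The arguments therefore go through the explicit Bayes formula for
  the posterior mean, defined at every z, in place of \<open>real_cond_exp\<close>. Merely weak
  convergence suffices, although second moments are not weakly continuous, because at each fixed z
  the Gaussian kernel damps y^2. A weak limit is not known beforehand to have a second moment, so
  its transport cost is first an extended real computed from distribution functions.

  The exponent in k^-2 comes from one balance, used in both directions: moving the input by a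
  distance d changes the error to first order in d but is charged k^2 d^2, and c d - k^2 d^2 is at
  most c^2 / (4 k^2), attained at d = c / (2 k^2). For the upper bound on the gap, c must be uniform
  over minimizers that are not known explicitly; it depends on \<open>Q\<close> only through the
  mean absolute value, which comparison with the competitor Q = P keeps bounded.\<close>

lemma real_distribution_gaussian: "0 < \<tau> \<Longrightarrow> real_distribution (gaussian \<tau>)"
  unfolding gaussian_def real_distribution_def real_distribution_axioms_def
  by (auto intro: prob_space_normal_density)

lemma integrable_gaussian_iff:
  fixes f :: "real \<Rightarrow> real"
  assumes [measurable]: "f \<in> borel_measurable borel"
  shows "integrable (gaussian \<tau>) f \<longleftrightarrow> integrable lborel (\<lambda>x. normal_density 0 \<tau> x * f x)"
  unfolding gaussian_def by (subst integrable_density) auto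

lemma integral_gaussian:
  fixes f :: "real \<Rightarrow> real"
  assumes [measurable]: "f \<in> borel_measurable borel"
  shows "integral\<^sup>L (gaussian \<tau>) f = (\<integral>x. normal_density 0 \<tau> x * f x \<partial>lborel)"
  unfolding gaussian_def by (subst integral_density) auto

lemma integrable_gaussian_power: "0 < \<tau> \<Longrightarrow> integrable (gaussian \<tau>) (\<lambda>x. x ^ n)"
  using integrable_normal_moment[of \<tau> 0 n] by (subst integrable_gaussian_iff) auto

lemma integral_gaussian_square:
  assumes "0 < \<tau>"
  shows "(\<integral>x. x\<^sup>2 \<partial>gaussian \<tau>) = \<tau>\<^sup>2"
proof -
  have "(\<integral>x. normal_density 0 \<tau> x * x\<^sup>2 \<partial>lborel) = fact 2 / (2 / \<tau>\<^sup>2)"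
    using integral_normal_moment_even[OF assms, of 0 1] by simp
  also have "\<dots> = \<tau>\<^sup>2" by (simp only: fact_2) simp
  finally show ?thesis by (simp add: integral_gaussian)
qed

lemma gaussian_in_P2: "0 < \<tau> \<Longrightarrow> gaussian \<tau> \<in> P2"
  by (simp add: P2_def real_distribution_gaussian integrable_gaussian_power)

lemma P2_integrable_id:
  assumes "Q \<in> P2"
  shows "integrable Q (\<lambda>x. x)"
proof -
  interpret real_distribution Q using assms by (simp add: P2_def)
  show ?thesis
    using assms by (auto simp: P2_def intro: square_integrable_imp_integrable[of "\<lambda>x. x"])
qed

section \<open>Posterior moments of a fixed input law\<close>

abbreviation \<phi> :: "real \<Rightarrow> real" where "\<phi> \<equiv> std_normal_density"

text \<open>The Lebesgue density of Y + N when Y has law \<open>Q\<close>.\<close>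

definition marginal :: "real measure \<Rightarrow> real \<Rightarrow> real" where
  "marginal Q z = (\<integral>y. \<phi> (z - y) \<partial>Q)"

text \<open>Bayes' formula for E[Y | Y + N = z], a version defined at every z. For a probability law
  on the Borel sets the denominator is positive (\<open>marginal_pos\<close>), so the default value
  of division by zero never intervenes.\<close>

definition posterior_mean :: "real measure \<Rightarrow> real \<Rightarrow> real" where
  "posterior_mean Q z = (\<integral>y. y * \<phi> (z - y) \<partial>Q) / marginal Q z"

lemma std_normal_density_le_1: "\<phi> x \<le> 1"
proof -
  have "1 \<le> sqrt (2 * pi)" using pi_gt3 by (simp add: real_le_rsqrt)
  then have "1 / sqrt (2 * pi) * exp (- x\<^sup>2 / 2) \<le> 1 * 1"
    by (intro mult_mono) auto
  then show ?thesis by (simp add: std_normal_density_def)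
qed

lemma bounded_if_bounded_outside_interval:
  fixes f :: "real \<Rightarrow> real"
  assumes a: "\<And>y. y \<ge> a \<Longrightarrow> \<bar>f y\<bar> < 1" and b: "\<And>y. y \<le> b \<Longrightarrow> \<bar>f y\<bar> < 1"
    and c: "compact (f ` {b..a})"
  shows "\<exists>B. \<forall>y. \<bar>f y\<bar> \<le> B"
proof -
  have "bounded (f ` {b..a})" using c by (rule compact_imp_bounded)
  then obtain B where "\<forall>u \<in> f ` {b..a}. norm u \<le> B"
    unfolding bounded_iff ..
  then have B: "\<bar>f y\<bar> \<le> B" if "y \<in> {b..a}" for y
    using that by simp
  have "\<bar>f y\<bar> \<le> max 1 B" for y
  proof -
    consider "y \<ge> a" | "y \<le> b" | "y \<in> {b..a}" by fastforce
    then show ?thesis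
    proof cases
      case 1 then show ?thesis using a[OF 1] by linarith
    next
      case 2 then show ?thesis using b[OF 2] by linarith
    next
      case 3 then show ?thesis using B[OF 3] by linarith
    qed
  qed
  then show ?thesis by blast
qed

text \<open>Gaussian decay beats every power. Hence y^n \<phi>(z - y) is a bounded continuous test
  function of y: it is integrable under every law, and weak convergence passes to its
  integral.\<close>

lemma bounded_moment_kernel: "\<exists>B. \<forall>y. \<bar>y ^ n * \<phi> (z - y)\<bar> \<le> B"
proof -
  have top: "((\<lambda>y. y ^ n * \<phi> (z - y)) \<longlongrightarrow> 0) at_top"
    unfolding std_normal_density_def by real_asymp
  have bot: "((\<lambda>y. y ^ n * \<phi> (z - y)) \<longlongrightarrow> 0) at_bot"
    unfolding std_normal_density_def by real_asymp
  have "\<exists>a. \<forall>y\<ge>a. \<bar>y ^ n * \<phi> (z - y)\<bar> < 1"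
    using tendstoD[OF top, of 1] by (simp add: eventually_at_top_linorder)
  then obtain a where a: "\<forall>y\<ge>a. \<bar>y ^ n * \<phi> (z - y)\<bar> < 1" ..
  have "\<exists>b. \<forall>y\<le>b. \<bar>y ^ n * \<phi> (z - y)\<bar> < 1"
    using tendstoD[OF bot, of 1] by (simp add: eventually_at_bot_linorder)
  then obtain b where b: "\<forall>y\<le>b. \<bar>y ^ n * \<phi> (z - y)\<bar> < 1" ..
  have c: "compact ((\<lambda>y. y ^ n * \<phi> (z - y)) ` {b..a})"
    unfolding std_normal_density_def
    by (intro compact_continuous_image continuous_intros) auto
  show ?thesis
    by (rule bounded_if_bounded_outside_interval[OF a[rule_format] b[rule_format] c])
qed

context real_distribution
begin

lemma prob_UNIV [simp]: "prob UNIV = 1"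
  using prob_space by simp

lemma integrable_moment_kernel: "integrable M (\<lambda>y. y ^ n * \<phi> (z - y))"
proof -
  obtain B where "\<forall>y. \<bar>y ^ n * \<phi> (z - y)\<bar> \<le> B" using bounded_moment_kernel by blast
  then show ?thesis by (intro integrable_const_bound[of _ B]) auto
qed

lemma integrable_kernel: "integrable M (\<lambda>y. \<phi> (z - y))"
  using integrable_moment_kernel[of 0] by simp

lemma integrable_mult_kernel: "integrable M (\<lambda>y. y * \<phi> (z - y))"
  using integrable_moment_kernel[of 1] by simp

lemma marginal_pos: "marginal M z > 0"
proof -
  have "(\<integral>y. \<phi> (z - y) \<partial>M) \<noteq> 0"
  proof
    assume "(\<integral>y. \<phi> (z - y) \<partial>M) = 0"
    then have "AE y in M. \<phi> (z - y) = 0"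
      by (subst (asm) integral_nonneg_eq_0_iff_AE) (auto simp: integrable_kernel)
    moreover have "\<phi> (z - y) \<noteq> 0" for y
      using normal_density_pos[of 1 0 "z - y"] by simp
    ultimately show False by simp
  qed
  moreover have "(\<integral>y. \<phi> (z - y) \<partial>M) \<ge> 0" by simp
  ultimately show ?thesis unfolding marginal_def by linarith
qed

lemma integral_mult_kernel: "(\<integral>y. y * \<phi> (z - y) \<partial>M) = posterior_mean M z * marginal M z"
  using marginal_pos[of z] by (simp add: posterior_mean_def)

lemma marginal_measurable [measurable]: "marginal M \<in> borel_measurable borel"
  unfolding marginal_def by measurable

lemma posterior_mean_measurable [measurable]: "posterior_mean M \<in> borel_measurable borel"
  unfolding posterior_mean_def by measurable

lemma integral_square_kernel:
  "(\<integral>y. (y - c)\<^sup>2 * \<phi> (z - y) \<partial>M) =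
     (\<integral>y. y\<^sup>2 * \<phi> (z - y) \<partial>M) - 2 * c * (posterior_mean M z * marginal M z) + c\<^sup>2 * marginal M z"
    "integrable M (\<lambda>y. (y - c)\<^sup>2 * \<phi> (z - y))"
proof -
  have *: "(\<lambda>y. (y - c)\<^sup>2 * \<phi> (z - y)) =
     (\<lambda>y. y\<^sup>2 * \<phi> (z - y) - 2 * c * (y * \<phi> (z - y)) + c\<^sup>2 * \<phi> (z - y))"
    by (auto simp: power2_eq_square algebra_simps)
  show "(\<integral>y. (y - c)\<^sup>2 * \<phi> (z - y) \<partial>M) =
     (\<integral>y. y\<^sup>2 * \<phi> (z - y) \<partial>M) - 2 * c * (posterior_mean M z * marginal M z) + c\<^sup>2 * marginal M z"
    unfolding * integral_mult_kernel[symmetric] unfolding marginal_def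
    using integrable_moment_kernel[of 2] integrable_kernel integrable_mult_kernel by simp
  show "integrable M (\<lambda>y. (y - c)\<^sup>2 * \<phi> (z - y))"
    unfolding * using integrable_moment_kernel[of 2] integrable_kernel integrable_mult_kernel by simp
qed

text \<open>Pythagoras at a fixed observation: the error of the guess c exceeds that of the
  posterior mean by their squared difference times the marginal density.\<close>

lemma posterior_mean_optimal:
  "(\<integral>y. (y - posterior_mean M z)\<^sup>2 * \<phi> (z - y) \<partial>M) \<le> (\<integral>y. (y - c)\<^sup>2 * \<phi> (z - y) \<partial>M)"
proof -
  have "0 \<le> (posterior_mean M z - c)\<^sup>2 * marginal M z"
    using marginal_pos[of z] by simp
  also have "\<dots> = (\<integral>y. (y - c)\<^sup>2 * \<phi> (z - y) \<partial>M) - (\<integral>y. (y - posterior_mean M z)\<^sup>2 * \<phi> (z - y) \<partial>M)"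
    unfolding integral_square_kernel(1)[of c] integral_square_kernel(1)[of "posterior_mean M z"]
    by algebra
  finally show ?thesis by simp
qed

text \<open>The kernel decreases in the distance \<open>t = |z - y|\<close>, so with \<open>a\<close> the mean of \<open>t\<close>
  the integral of \<open>(t - a) (\<phi> t - \<phi> a)\<close> is nonpositive (Chebyshev's association inequality).\<close>

lemma abs_posterior_mean_le:
  assumes "integrable M (\<lambda>y. y)"
  shows "\<bar>posterior_mean M z\<bar> \<le> 2 * \<bar>z\<bar> + (\<integral>y. \<bar>y\<bar> \<partial>M)"
proof -
  define a where "a = (\<integral>y. \<bar>z - y\<bar> \<partial>M)"
  have i1: "integrable M (\<lambda>y. \<bar>z - y\<bar>)" using assms by auto
  have i2: "integrable M (\<lambda>y. \<bar>z - y\<bar> * \<phi> (z - y))"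
    by (rule Bochner_Integration.integrable_bound[OF i1])
       (auto simp: abs_mult std_normal_density_le_1 intro!: mult_left_le)
  have anti: "(\<bar>z - y\<bar> - a) * (\<phi> (z - y) - \<phi> a) \<le> 0" for y
  proof -
    have a0: "0 \<le> a" unfolding a_def by simp
    have mono: "\<phi> u \<le> \<phi> v" if "\<bar>v\<bar> \<le> \<bar>u\<bar>" for u v
      using that by (auto simp: std_normal_density_def abs_le_square_iff divide_right_mono)
    show ?thesis
    proof (cases "\<bar>z - y\<bar> \<le> a")
      case True
      then have "\<phi> a \<le> \<phi> (z - y)" using mono[of "z-y" a] a0 by auto
      then show ?thesis using True by (intro mult_nonpos_nonneg) auto
    next
      case False
      then have "\<phi> (z - y) \<le> \<phi> a" using mono[of a "z-y"] a0 by auto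
      then show ?thesis using False by (intro mult_nonneg_nonpos) auto
    qed
  qed
  have "(\<integral>y. (\<bar>z - y\<bar> - a) * (\<phi> (z - y) - \<phi> a) \<partial>M) \<le> (\<integral>y. 0 \<partial>M)"
    using i1 i2 integrable_kernel[of z] anti
    by (intro integral_mono) (auto simp: algebra_simps)
  also have "(\<lambda>y. (\<bar>z - y\<bar> - a) * (\<phi> (z - y) - \<phi> a)) =
      (\<lambda>y. \<bar>z - y\<bar> * \<phi> (z - y) - a * \<phi> (z - y) - \<phi> a * \<bar>z - y\<bar> + a * \<phi> a)"
    by (auto simp: algebra_simps)
  also have "(\<integral>y. \<bar>z - y\<bar> * \<phi> (z - y) - a * \<phi> (z - y) - \<phi> a * \<bar>z - y\<bar> + a * \<phi> a \<partial>M) =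
      (\<integral>y. \<bar>z - y\<bar> * \<phi> (z - y) \<partial>M) - a * marginal M z"
    using i1 i2 integrable_kernel[of z] by (simp add: marginal_def a_def prob_space)
  finally have 1: "(\<integral>y. \<bar>z - y\<bar> * \<phi> (z - y) \<partial>M) \<le> a * marginal M z" by simp
  \<comment> \<open>The difference between posterior mean and z is the kernel average of y - z. Its
    modulus is at most the kernel average of |z - y|, which the association inequality bounds by the
    plain average a.\<close>
  have "(posterior_mean M z - z) * marginal M z = (\<integral>y. y * \<phi> (z - y) \<partial>M) - z * (\<integral>y. \<phi> (z - y) \<partial>M)"
    by (simp add: integral_mult_kernel marginal_def left_diff_distrib)
  also have "\<dots> = (\<integral>y. (y - z) * \<phi> (z - y) \<partial>M)"
    using integrable_mult_kernel[of z] integrable_kernel[of z]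
    by (simp add: left_diff_distrib)
  also have "\<bar>\<dots>\<bar> \<le> (\<integral>y. \<bar>z - y\<bar> * \<phi> (z - y) \<partial>M)"
    by (rule order_trans[OF integral_abs_bound])
       (auto simp: abs_mult abs_minus_commute)
  finally have "\<bar>posterior_mean M z - z\<bar> * \<bar>marginal M z\<bar> \<le> (\<integral>y. \<bar>z - y\<bar> * \<phi> (z - y) \<partial>M)"
    by (simp only: abs_mult)
  with 1 have "\<bar>posterior_mean M z - z\<bar> * marginal M z \<le> a * marginal M z"
    unfolding abs_of_pos[OF marginal_pos] by linarith
  then have "\<bar>posterior_mean M z - z\<bar> \<le> a"
    using marginal_pos[of z] by (simp add: mult_le_cancel_right)
  moreover have "a \<le> (\<integral>y. \<bar>z\<bar> + \<bar>y\<bar> \<partial>M)"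
    unfolding a_def using assms by (intro integral_mono) auto
  then have "a \<le> \<bar>z\<bar> + (\<integral>y. \<bar>y\<bar> \<partial>M)"
    using assms by (simp add: prob_space)
  ultimately show ?thesis by linarith
qed

section \<open>Joint law of input and observation\<close>

lemma nn_integral_noisy:
  assumes [measurable]: "h \<in> borel_measurable (borel \<Otimes>\<^sub>M borel)"
  shows "(\<integral>\<^sup>+\<omega>. h (fst \<omega>, fst \<omega> + snd \<omega>) \<partial>(M \<Otimes>\<^sub>M gaussian 1)) =
         (\<integral>\<^sup>+y. \<integral>\<^sup>+z. ennreal (\<phi> (z - y)) * h (y, z) \<partial>lborel \<partial>M)"
proof -
  interpret g: real_distribution "gaussian 1" by (rule real_distribution_gaussian) simp
  have [measurable_cong]: "sets (gaussian 1) = sets borel" by simp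
  have "(\<integral>\<^sup>+\<omega>. h (fst \<omega>, fst \<omega> + snd \<omega>) \<partial>(M \<Otimes>\<^sub>M gaussian 1)) =
      (\<integral>\<^sup>+y. \<integral>\<^sup>+n. h (y, y + n) \<partial>gaussian 1 \<partial>M)"
    by (subst g.nn_integral_fst[symmetric]) auto
  also have "\<dots> = (\<integral>\<^sup>+y. \<integral>\<^sup>+n. ennreal (\<phi> n) * h (y, y + n) \<partial>lborel \<partial>M)"
    unfolding gaussian_def
    by (intro nn_integral_cong, subst nn_integral_density) auto
  also have "\<dots> = (\<integral>\<^sup>+y. \<integral>\<^sup>+z. ennreal (\<phi> (z - y)) * h (y, z) \<partial>lborel \<partial>M)"
  proof (rule nn_integral_cong)
    fix y
    show "(\<integral>\<^sup>+n. ennreal (\<phi> n) * h (y, y + n) \<partial>lborel) = (\<integral>\<^sup>+z. ennreal (\<phi> (z - y)) * h (y, z) \<partial>lborel)"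
      using nn_integral_real_affine[of "\<lambda>z. ennreal (\<phi> (z - y)) * h (y, z)" 1 y] by (simp add: add.commute)
  qed
  finally show ?thesis .
qed

text \<open>Equality of the measures, beyond equality of nonnegative integrals, is what allows
  signed integrands to be transferred in \<open>integral_noisy\<close>.\<close>

lemma distr_noisy:
  "distr (M \<Otimes>\<^sub>M gaussian 1) (M \<Otimes>\<^sub>M lborel) (\<lambda>\<omega>. (fst \<omega>, fst \<omega> + snd \<omega>)) =
   density (M \<Otimes>\<^sub>M lborel) (\<lambda>p. ennreal (\<phi> (snd p - fst p)))"
proof (rule measure_eqI)
  interpret g: real_distribution "gaussian 1" by (rule real_distribution_gaussian) simp
  have [measurable_cong]: "sets (gaussian 1) = sets borel" by simp
  fix A assume "A \<in> sets (distr (M \<Otimes>\<^sub>M gaussian 1) (M \<Otimes>\<^sub>M lborel) (\<lambda>\<omega>. (fst \<omega>, fst \<omega> + snd \<omega>)))"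
  then have A: "A \<in> sets (M \<Otimes>\<^sub>M lborel)" by simp
  moreover have "sets (M \<Otimes>\<^sub>M lborel) = sets (borel \<Otimes>\<^sub>M (borel :: real measure))"
    by (intro sets_pair_measure_cong) auto
  ultimately have A'[measurable]: "A \<in> sets (borel \<Otimes>\<^sub>M borel)" "A \<in> sets (M \<Otimes>\<^sub>M lborel)" by simp_all
  have "emeasure (distr (M \<Otimes>\<^sub>M gaussian 1) (M \<Otimes>\<^sub>M lborel) (\<lambda>\<omega>. (fst \<omega>, fst \<omega> + snd \<omega>))) A =
     (\<integral>\<^sup>+p. indicator A p \<partial>distr (M \<Otimes>\<^sub>M gaussian 1) (M \<Otimes>\<^sub>M lborel) (\<lambda>\<omega>. (fst \<omega>, fst \<omega> + snd \<omega>)))"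
    using A by simp
  also have "\<dots> = (\<integral>\<^sup>+\<omega>. indicator A (fst \<omega>, fst \<omega> + snd \<omega>) \<partial>(M \<Otimes>\<^sub>M gaussian 1))"
    by (subst nn_integral_distr) auto
  also have "\<dots> = (\<integral>\<^sup>+y. \<integral>\<^sup>+z. ennreal (\<phi> (z - y)) * indicator A (y, z) \<partial>lborel \<partial>M)"
    by (subst nn_integral_noisy) auto
  also have "\<dots> = (\<integral>\<^sup>+p. ennreal (\<phi> (snd p - fst p)) * indicator A p \<partial>(M \<Otimes>\<^sub>M lborel))"
    by (subst lborel.nn_integral_fst[symmetric]) auto
  also have "\<dots> = emeasure (density (M \<Otimes>\<^sub>M lborel) (\<lambda>p. ennreal (\<phi> (snd p - fst p)))) A"
    by (subst emeasure_density) auto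
  finally show "emeasure (distr (M \<Otimes>\<^sub>M gaussian 1) (M \<Otimes>\<^sub>M lborel) (\<lambda>\<omega>. (fst \<omega>, fst \<omega> + snd \<omega>))) A =
     emeasure (density (M \<Otimes>\<^sub>M lborel) (\<lambda>p. ennreal (\<phi> (snd p - fst p)))) A" .
qed simp

lemma integral_noisy:
  fixes h :: "real \<Rightarrow> real \<Rightarrow> real"
  assumes [measurable]: "case_prod h \<in> borel_measurable (borel \<Otimes>\<^sub>M borel)"
    and int: "integrable (M \<Otimes>\<^sub>M gaussian 1) (\<lambda>\<omega>. h (fst \<omega>) (fst \<omega> + snd \<omega>))"
  shows "(\<integral>\<omega>. h (fst \<omega>) (fst \<omega> + snd \<omega>) \<partial>(M \<Otimes>\<^sub>M gaussian 1)) =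
         (\<integral>z. \<integral>y. \<phi> (z - y) * h y z \<partial>M \<partial>lborel)"
proof -
  interpret g: real_distribution "gaussian 1" by (rule real_distribution_gaussian) simp
  have [measurable_cong]: "sets (gaussian 1) = sets borel" by simp
  interpret pair_sigma_finite M lborel ..
  let ?T = "\<lambda>\<omega>::real\<times>real. (fst \<omega>, fst \<omega> + snd \<omega>)"
  have "integrable (distr (M \<Otimes>\<^sub>M gaussian 1) (M \<Otimes>\<^sub>M lborel) ?T) (case_prod h)"
    using int by (subst integrable_distr_eq) auto
  then have i: "integrable (M \<Otimes>\<^sub>M lborel) (\<lambda>(y, z). \<phi> (z - y) * h y z)"
    unfolding distr_noisy
    by (subst (asm) integrable_density) (auto simp: case_prod_unfold)
  have "(\<integral>\<omega>. h (fst \<omega>) (fst \<omega> + snd \<omega>) \<partial>(M \<Otimes>\<^sub>M gaussian 1)) =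
      integral\<^sup>L (distr (M \<Otimes>\<^sub>M gaussian 1) (M \<Otimes>\<^sub>M lborel) ?T) (case_prod h)"
    by (subst integral_distr) auto
  also have "\<dots> = integral\<^sup>L (M \<Otimes>\<^sub>M lborel) (\<lambda>(y, z). \<phi> (z - y) * h y z)"
    unfolding distr_noisy
    by (subst integral_density) (auto simp: case_prod_unfold)
  also have "\<dots> = (\<integral>z. \<integral>y. \<phi> (z - y) * h y z \<partial>M \<partial>lborel)"
    using i by (rule integral_snd[symmetric])
  finally show ?thesis .
qed

lemma integrable_fst_gaussian:
  fixes f :: "real \<Rightarrow> real"
  assumes "integrable M f"
  shows "integrable (M \<Otimes>\<^sub>M gaussian 1) (\<lambda>\<omega>. f (fst \<omega>))"
proof -
  interpret g: real_distribution "gaussian 1" by (rule real_distribution_gaussian) simp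
  have "integrable (distr (M \<Otimes>\<^sub>M gaussian 1) M fst) f"
    using assms by (simp add: g.distr_pair_fst)
  then show ?thesis by (rule integrable_distr[rotated]) simp
qed


lemma integrable_indicator_of_sum:
  fixes f :: "real \<times> real \<Rightarrow> real"
  assumes f: "integrable (M \<Otimes>\<^sub>M gaussian 1) f" and [measurable]: "B \<in> sets borel"
  shows "integrable (M \<Otimes>\<^sub>M gaussian 1) (\<lambda>\<omega>. indicat_real B (fst \<omega> + snd \<omega>) * f \<omega>)"
proof (rule Bochner_Integration.integrable_bound[OF f])
  have [measurable_cong]: "sets (gaussian 1) = sets borel" by (simp add: gaussian_def)
  have [measurable]: "f \<in> borel_measurable (M \<Otimes>\<^sub>M gaussian 1)" using f by simp
  show "(\<lambda>\<omega>. indicat_real B (fst \<omega> + snd \<omega>) * f \<omega>) \<in> borel_measurable (M \<Otimes>\<^sub>M gaussian 1)"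
    by measurable
qed (auto simp: indicator_def)

lemma integrable_snd_gaussian:
  fixes f :: "real \<Rightarrow> real"
  assumes f: "integrable (gaussian 1) f"
  shows "integrable (M \<Otimes>\<^sub>M gaussian 1) (\<lambda>\<omega>. f (snd \<omega>))"
proof -
  interpret g: real_distribution "gaussian 1" by (rule real_distribution_gaussian) simp
  interpret p: pair_sigma_finite "gaussian 1" M ..
  have "integrable (distr (gaussian 1 \<Otimes>\<^sub>M M) (gaussian 1) fst) f"
    using f by (simp add: distr_pair_fst)
  then have "integrable (gaussian 1 \<Otimes>\<^sub>M M) (\<lambda>\<omega>. f (fst \<omega>))"
    by (rule integrable_distr[rotated]) simp
  from p.integrable_product_swap[OF this] show ?thesis
    by (simp add: case_prod_unfold)
qed

text \<open>Linear growth of the posterior mean lets it inherit the second moments of Y and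
  N.\<close>

lemma
  assumes Q: "M \<in> P2"
  shows integrable_posterior_mean:
      "integrable (M \<Otimes>\<^sub>M gaussian 1) (\<lambda>\<omega>. posterior_mean M (fst \<omega> + snd \<omega>))" (is ?A)
    and integrable_square_error:
      "integrable (M \<Otimes>\<^sub>M gaussian 1) (\<lambda>\<omega>. (fst \<omega> - posterior_mean M (fst \<omega> + snd \<omega>))\<^sup>2)" (is ?B)
proof -
  interpret g: real_distribution "gaussian 1" by (rule real_distribution_gaussian) simp
  interpret N: prob_space "M \<Otimes>\<^sub>M gaussian 1"
    by (intro prob_space_pair prob_space_axioms g.prob_space_axioms)
  have [measurable_cong]: "sets (gaussian 1) = sets borel" by simp
  have i1: "integrable M (\<lambda>y. y)" using P2_integrable_id[OF Q] .
  have i2: "integrable M (\<lambda>y. y\<^sup>2)" using Q by (simp add: P2_def)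
  define m where "m = (\<integral>y. \<bar>y\<bar> \<partial>M)"
  have m: "0 \<le> m" by (simp add: m_def)
  have g: "\<bar>posterior_mean M z\<bar> \<le> 2 * \<bar>z\<bar> + m" for z
    using abs_posterior_mean_le[OF i1, of z] by (simp add: m_def)
  have n2: "integrable (M \<Otimes>\<^sub>M gaussian 1) (\<lambda>\<omega>. (snd \<omega>)\<^sup>2)"
    using integrable_snd_gaussian[of "\<lambda>x. x\<^sup>2"] integrable_gaussian_power[of 1 2] by simp
  have f2: "integrable (M \<Otimes>\<^sub>M gaussian 1) (\<lambda>\<omega>. (fst \<omega>)\<^sup>2)"
    using integrable_fst_gaussian[OF i2] .
  have p: "(posterior_mean M (y + n))\<^sup>2 \<le> 12 * y\<^sup>2 + 12 * n\<^sup>2 + 3 * m\<^sup>2" for y n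
  proof -
    have "(posterior_mean M (y + n))\<^sup>2 \<le> (2 * \<bar>y\<bar> + 2 * \<bar>n\<bar> + m)\<^sup>2"
    proof (rule power2_le_iff_abs_le[THEN iffD2])
      have "2 * \<bar>y + n\<bar> + m \<le> 2 * \<bar>y\<bar> + 2 * \<bar>n\<bar> + m"
        using abs_triangle_ineq[of y n] by simp
      with g[of "y + n"] show "\<bar>posterior_mean M (y + n)\<bar> \<le> 2 * \<bar>y\<bar> + 2 * \<bar>n\<bar> + m"
        by (rule order_trans)
    qed (use m in simp)
    \<comment> \<open>This is (a + b + c)^2 \<le> 3 (a^2 + b^2 + c^2) with a = 2|y|, b = 2|n|, c =
      m.\<close>
    also have "\<dots> \<le> 12 * y\<^sup>2 + 12 * n\<^sup>2 + 3 * m\<^sup>2"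
    proof -
      have "0 \<le> (2 * \<bar>y\<bar> - 2 * \<bar>n\<bar>)\<^sup>2 + (2 * \<bar>y\<bar> - m)\<^sup>2 + (2 * \<bar>n\<bar> - m)\<^sup>2" by simp
      also have "\<dots> = 3 * (4 * \<bar>y\<bar>\<^sup>2 + 4 * \<bar>n\<bar>\<^sup>2 + m\<^sup>2) - (2 * \<bar>y\<bar> + 2 * \<bar>n\<bar> + m)\<^sup>2"
        by algebra
      finally show ?thesis by simp
    qed
    finally show ?thesis .
  qed
  have p2: "integrable (M \<Otimes>\<^sub>M gaussian 1) (\<lambda>\<omega>. (posterior_mean M (fst \<omega> + snd \<omega>))\<^sup>2)"
    by (rule Bochner_Integration.integrable_bound[of _ "\<lambda>\<omega>. 12 * (fst \<omega>)\<^sup>2 + 12 * (snd \<omega>)\<^sup>2 + 3 * m\<^sup>2"])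
       (use n2 f2 p in \<open>auto intro!: abs_le_D1 order_trans[OF p] Bochner_Integration.integrable_add\<close>)
  then show ?A
    by (rule N.square_integrable_imp_integrable[rotated]) measurable
  show ?B
  proof (rule Bochner_Integration.integrable_bound)
    show "integrable (M \<Otimes>\<^sub>M gaussian 1) (\<lambda>\<omega>. 2 * (fst \<omega>)\<^sup>2 + 2 * (posterior_mean M (fst \<omega> + snd \<omega>))\<^sup>2)"
      using f2 p2 by simp
    have "(a - b)\<^sup>2 \<le> 2 * a\<^sup>2 + 2 * b\<^sup>2" for a b :: real
      using zero_le_power2[of "a + b"] by (simp add: power2_diff power2_sum)
    then show "AE \<omega> in M \<Otimes>\<^sub>M gaussian 1. norm ((fst \<omega> - posterior_mean M (fst \<omega> + snd \<omega>))\<^sup>2)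
        \<le> norm (2 * (fst \<omega>)\<^sup>2 + 2 * (posterior_mean M (fst \<omega> + snd \<omega>))\<^sup>2)"
      by auto
  qed measurable
qed

text \<open>Events of the observation have the form {Y + N \<in> B}. Integrating over such an event
  puts the factor 1_B(z) into the integral over z, and at fixed z the kernel-weighted integrals of y
  and of the posterior mean agree. This identifies the inner conditional expectation; the outer one
  disappears because a conditional expectation preserves the integral.\<close>

lemma mmse_eq_integral_square_error:
  assumes Q: "M \<in> P2"
  shows "mmse M = (\<integral>\<omega>. (fst \<omega> - posterior_mean M (fst \<omega> + snd \<omega>))\<^sup>2 \<partial>(M \<Otimes>\<^sub>M gaussian 1))"
proof -
  let ?N = "M \<Otimes>\<^sub>M gaussian 1"
  let ?Z = "\<lambda>\<omega>::real\<times>real. fst \<omega> + snd \<omega>"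
  define F where "F = vimage_algebra (space ?N) ?Z borel"
  let ?g = "\<lambda>\<omega>. posterior_mean M (?Z \<omega>)"
  interpret g: real_distribution "gaussian 1" by (rule real_distribution_gaussian) simp
  have [measurable_cong]: "sets (gaussian 1) = sets borel" by simp
  interpret N: prob_space ?N
    by (intro prob_space_pair prob_space_axioms g.prob_space_axioms)
  have Z: "?Z \<in> borel_measurable ?N" by measurable
  have "subalgebra ?N F"
    unfolding subalgebra_def F_def
  proof (intro conjI)
    show "sets (vimage_algebra (space ?N) ?Z borel) \<subseteq> sets ?N"
      by (subst sets_vimage_algebra2) (auto simp only: space_borel Pi_iff UNIV_I intro: measurable_sets[OF Z])
  qed simp
  then interpret sub: finite_measure_subalgebra ?N F
    by unfold_locales
  have ZF [measurable]: "?Z \<in> borel_measurable F"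
    unfolding F_def by (rule measurable_vimage_algebra1) auto
  note i1 = integrable_fst_gaussian[OF P2_integrable_id[OF Q]]
  have ce: "AE \<omega> in ?N. real_cond_exp ?N F fst \<omega> = ?g \<omega>"
  proof (rule sub.real_cond_exp_charact)
    fix A assume "A \<in> sets F"
    then obtain B where B[measurable]: "B \<in> sets borel" and A: "A = ?Z -` B \<inter> space ?N"
      unfolding F_def by (auto simp: sets_vimage_algebra2)
    have *: "indicat_real A \<omega> = indicat_real B (?Z \<omega>)" if "\<omega> \<in> space ?N" for \<omega>
      using that by (auto simp: A indicator_def)
    have mA [measurable]: "A \<in> sets ?N" unfolding A using Z by measurable
    have "(\<integral>\<omega>\<in>A. fst \<omega> \<partial>?N) = (\<integral>\<omega>. indicat_real B (?Z \<omega>) * fst \<omega> \<partial>?N)"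
      unfolding set_lebesgue_integral_def by (rule Bochner_Integration.integral_cong) (auto simp: *)
    also have "\<dots> = (\<integral>z. \<integral>y. \<phi> (z - y) * (indicat_real B z * y) \<partial>M \<partial>lborel)"
      by (rule integral_noisy) (use integrable_indicator_of_sum[OF i1 B] in auto)
    also have "\<dots> = (\<integral>z. \<integral>y. \<phi> (z - y) * (indicat_real B z * posterior_mean M z) \<partial>M \<partial>lborel)"
    proof (rule Bochner_Integration.integral_cong)
      fix z
      have "(\<integral>y. \<phi> (z - y) * (indicat_real B z * y) \<partial>M) = indicat_real B z * (\<integral>y. y * \<phi> (z - y) \<partial>M)"
        by (subst integral_mult_right_zero[symmetric]) (simp add: ac_simps)
      also have "\<dots> = (indicat_real B z * posterior_mean M z) * (\<integral>y. \<phi> (z - y) \<partial>M)"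
        by (simp add: integral_mult_kernel marginal_def)
      also have "\<dots> = (\<integral>y. \<phi> (z - y) * (indicat_real B z * posterior_mean M z) \<partial>M)"
        by simp
      finally show "(\<integral>y. \<phi> (z - y) * (indicat_real B z * y) \<partial>M) =
        (\<integral>y. \<phi> (z - y) * (indicat_real B z * posterior_mean M z) \<partial>M)" .
    qed simp
    also have "\<dots> = (\<integral>\<omega>. indicat_real B (?Z \<omega>) * ?g \<omega> \<partial>?N)"
      by (rule integral_noisy[symmetric])
         (use integrable_indicator_of_sum[OF integrable_posterior_mean[OF Q] B] in auto)
    also have "\<dots> = (\<integral>\<omega>\<in>A. ?g \<omega> \<partial>?N)"
      unfolding set_lebesgue_integral_def by (rule Bochner_Integration.integral_cong) (auto simp: *)
    finally show "(\<integral>\<omega>\<in>A. fst \<omega> \<partial>?N) = (\<integral>\<omega>\<in>A. ?g \<omega> \<partial>?N)" .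
  qed (use i1 integrable_posterior_mean[OF Q] in auto)
  have "mmse M = (\<integral>\<omega>. real_cond_exp ?N F (\<lambda>\<omega>. (fst \<omega> - real_cond_exp ?N F fst \<omega>)\<^sup>2) \<omega> \<partial>?N)"
    by (simp add: mmse_def cond_variance_def Let_def F_def)
  also have "\<dots> = (\<integral>\<omega>. real_cond_exp ?N F (\<lambda>\<omega>. (fst \<omega> - ?g \<omega>)\<^sup>2) \<omega> \<partial>?N)"
  proof (rule integral_cong_AE)
    have "real_cond_exp ?N F fst \<in> borel_measurable ?N"
      by measurable
    then show "AE \<omega> in ?N. real_cond_exp ?N F (\<lambda>\<omega>. (fst \<omega> - real_cond_exp ?N F fst \<omega>)\<^sup>2) \<omega> =
        real_cond_exp ?N F (\<lambda>\<omega>. (fst \<omega> - ?g \<omega>)\<^sup>2) \<omega>"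
      using ce by (intro sub.real_cond_exp_cong) auto
  qed auto
  also have "\<dots> = (\<integral>\<omega>. (fst \<omega> - ?g \<omega>)\<^sup>2 \<partial>?N)"
    by (rule sub.real_cond_exp_int(2)[OF integrable_square_error[OF Q]])
  finally show ?thesis .
qed

lemma ennreal_mmse:
  assumes Q: "M \<in> P2"
  shows "ennreal (mmse M) = (\<integral>\<^sup>+z. \<integral>y. (y - posterior_mean M z)\<^sup>2 * \<phi> (z - y) \<partial>M \<partial>lborel)"
proof -
  let ?N = "M \<Otimes>\<^sub>M gaussian 1"
  let ?g = "\<lambda>\<omega>. posterior_mean M (fst \<omega> + snd \<omega>)"
  interpret g: real_distribution "gaussian 1" by (rule real_distribution_gaussian) simp
  have [measurable_cong]: "sets (gaussian 1) = sets borel" by simp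
  have "ennreal (mmse M) = (\<integral>\<^sup>+\<omega>. ennreal ((fst \<omega> - ?g \<omega>)\<^sup>2) \<partial>?N)"
    using integrable_square_error[OF Q] by (simp add: nn_integral_eq_integral mmse_eq_integral_square_error[OF Q])
  also have "\<dots> = (\<integral>\<^sup>+y. \<integral>\<^sup>+z. ennreal (\<phi> (z - y)) * ennreal ((y - posterior_mean M z)\<^sup>2) \<partial>lborel \<partial>M)"
    using nn_integral_noisy[of "\<lambda>(y, z). ennreal ((y - posterior_mean M z)\<^sup>2)"] by simp
  also have "\<dots> = (\<integral>\<^sup>+z. \<integral>\<^sup>+y. ennreal (\<phi> (z - y)) * ennreal ((y - posterior_mean M z)\<^sup>2) \<partial>M \<partial>lborel)"
  proof -
    interpret pair_sigma_finite lborel M ..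
    show ?thesis by (rule Fubini') measurable
  qed
  also have "\<dots> = (\<integral>\<^sup>+z. \<integral>y. (y - posterior_mean M z)\<^sup>2 * \<phi> (z - y) \<partial>M \<partial>lborel)"
  proof (rule nn_integral_cong)
    fix z
    have "(\<integral>\<^sup>+y. ennreal (\<phi> (z - y)) * ennreal ((y - posterior_mean M z)\<^sup>2) \<partial>M) =
        (\<integral>\<^sup>+y. ennreal ((y - posterior_mean M z)\<^sup>2 * \<phi> (z - y)) \<partial>M)"
      by (simp add: ennreal_mult mult.commute)
    also have "\<dots> = (\<integral>y. (y - posterior_mean M z)\<^sup>2 * \<phi> (z - y) \<partial>M)"
      by (intro nn_integral_eq_integral integral_square_kernel(2)) simp
    finally show "(\<integral>\<^sup>+y. ennreal (\<phi> (z - y)) * ennreal ((y - posterior_mean M z)\<^sup>2) \<partial>M) =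
        (\<integral>y. (y - posterior_mean M z)\<^sup>2 * \<phi> (z - y) \<partial>M)" .
  qed
  finally show ?thesis .
qed

text \<open>The comparison is made at each z separately, so \<open>g\<close> may be any function. It
  is applied with the posterior mean of another law and with a sign detector.\<close>

lemma mmse_le_estimator:
  assumes Q: "M \<in> P2"
  shows "ennreal (mmse M) \<le> (\<integral>\<^sup>+z. \<integral>\<^sup>+y. ennreal ((y - g z)\<^sup>2 * \<phi> (z - y)) \<partial>M \<partial>lborel)"
proof -
  have "(\<integral>\<^sup>+z. \<integral>y. (y - posterior_mean M z)\<^sup>2 * \<phi> (z - y) \<partial>M \<partial>lborel) \<le>
      (\<integral>\<^sup>+z. \<integral>\<^sup>+y. ennreal ((y - g z)\<^sup>2 * \<phi> (z - y)) \<partial>M \<partial>lborel)"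
  proof (rule nn_integral_mono)
    fix z
    have "(\<integral>\<^sup>+y. ennreal ((y - g z)\<^sup>2 * \<phi> (z - y)) \<partial>M) = (\<integral>y. (y - g z)\<^sup>2 * \<phi> (z - y) \<partial>M)"
      by (intro nn_integral_eq_integral integral_square_kernel(2)) simp
    then show "ennreal (\<integral>y. (y - posterior_mean M z)\<^sup>2 * \<phi> (z - y) \<partial>M) \<le> (\<integral>\<^sup>+y. ennreal ((y - g z)\<^sup>2 * \<phi> (z - y)) \<partial>M)"
      using posterior_mean_optimal[of z "g z"] by (simp add: ennreal_leI)
  qed
  then show ?thesis by (simp add: ennreal_mmse[OF Q])
qed

end

lemma P2_real_distribution: "Q \<in> P2 \<Longrightarrow> real_distribution Q"
  by (simp add: P2_def)

lemma mmse_nonneg: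
  assumes "Q \<in> P2"
  shows "0 \<le> mmse Q"
proof -
  interpret real_distribution Q using assms by (rule P2_real_distribution)
  show ?thesis
    unfolding mmse_eq_integral_square_error[OF assms] by simp
qed

section \<open>Gaussian inputs\<close>

text \<open>Gaussian conjugacy: the joint density of (Y, Y + N) factors into the law N(0, 1 +
  \<tau>^2) of the observation and a normal posterior of the input. The exponents match by
  completing the square in y.\<close>

lemma normal_density_times_kernel:
  assumes "0 < \<tau>"
  shows "normal_density 0 \<tau> y * \<phi> (z - y) =
    normal_density 0 (sqrt (1 + \<tau>\<^sup>2)) z * normal_density (\<tau>\<^sup>2 / (1 + \<tau>\<^sup>2) * z) (\<tau> / sqrt (1 + \<tau>\<^sup>2)) y"
proof -
  have pos: "0 < 1 + \<tau>\<^sup>2" by (simp add: add_pos_nonneg)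
  have s: "(\<tau> / sqrt (1 + \<tau>\<^sup>2))\<^sup>2 = \<tau>\<^sup>2 / (1 + \<tau>\<^sup>2)"
    using pos by (simp add: power_divide)
  have "sqrt (2 * pi * \<tau>\<^sup>2) * sqrt (2 * pi) = sqrt (2 * pi * (1 + \<tau>\<^sup>2)) * sqrt (2 * pi * (\<tau>\<^sup>2 / (1 + \<tau>\<^sup>2)))"
    unfolding real_sqrt_mult[symmetric] using pos by simp
  then have 1: "1 / sqrt (2 * pi * \<tau>\<^sup>2) * (1 / sqrt (2 * pi)) =
      1 / sqrt (2 * pi * (1 + \<tau>\<^sup>2)) * (1 / sqrt (2 * pi * (\<tau>\<^sup>2 / (1 + \<tau>\<^sup>2))))"
    by simp
  define a where "a = 1 + \<tau>\<^sup>2"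
  have a: "a \<noteq> 0" "\<tau>\<^sup>2 = a - 1" "a - 1 \<noteq> 0" using pos assms by (auto simp: a_def)
  have E: "y\<^sup>2 / (a - 1) + (z - y)\<^sup>2 = z\<^sup>2 / a + (y - (a - 1) / a * z)\<^sup>2 / ((a - 1) / a)"
    using a(1,3) by (simp add: divide_simps) (simp add: power2_eq_square algebra_simps)
  have a1: "1 + (a - 1) = a" by simp
  have aux: "- (p / 2) + - (q / 2) = - (r / 2) + - (t / 2)" if "p + q = r + t" for p q r t :: real
    using that by simp
  have half: "u / (2 * b) = u / b / 2" for u b :: real by simp
  have 2: "- (y - 0)\<^sup>2 / (2 * \<tau>\<^sup>2) + - (z - y)\<^sup>2 / 2 =
      - (z - 0)\<^sup>2 / (2 * (1 + \<tau>\<^sup>2)) + - (y - \<tau>\<^sup>2 / (1 + \<tau>\<^sup>2) * z)\<^sup>2 / (2 * (\<tau>\<^sup>2 / (1 + \<tau>\<^sup>2)))"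
    unfolding a(2) a1 half diff_0_right minus_divide_left[symmetric] by (rule aux[OF E])
  have "normal_density 0 \<tau> y * \<phi> (z - y) =
      (1 / sqrt (2 * pi * \<tau>\<^sup>2) * (1 / sqrt (2 * pi))) * exp (- (y - 0)\<^sup>2 / (2 * \<tau>\<^sup>2) + - (z - y)\<^sup>2 / 2)"
    unfolding normal_density_def std_normal_density_def exp_add by (simp add: mult_ac)
  also have "\<dots> = normal_density 0 (sqrt (1 + \<tau>\<^sup>2)) z * normal_density (\<tau>\<^sup>2 / (1 + \<tau>\<^sup>2) * z) (\<tau> / sqrt (1 + \<tau>\<^sup>2)) y"
    unfolding 1 2 unfolding normal_density_def s exp_add using pos by (simp add: mult_ac)
  finally show ?thesis .
qed

text \<open>The posterior variance c is the same for every observation, so integrating it against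
  the density of the observation returns c.\<close>

lemma mmse_gaussian:
  assumes "0 < \<tau>"
  shows "mmse (gaussian \<tau>) = \<tau>\<^sup>2 / (1 + \<tau>\<^sup>2)"
proof -
  interpret real_distribution "gaussian \<tau>" using assms by (rule real_distribution_gaussian)
  define s where "s = \<tau> / sqrt (1 + \<tau>\<^sup>2)"
  define f where "f = normal_density 0 (sqrt (1 + \<tau>\<^sup>2))"
  define c where "c = \<tau>\<^sup>2 / (1 + \<tau>\<^sup>2)"
  have pos: "0 < 1 + \<tau>\<^sup>2" by (simp add: add_pos_nonneg)
  have s: "0 < s" "s\<^sup>2 = c"
    using pos assms by (simp_all add: s_def c_def power_divide)
  have int: "(\<integral>y. h y * \<phi> (z - y) \<partial>gaussian \<tau>) = f z * (\<integral>y. normal_density (c * z) s y * h y \<partial>lborel)"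
    if [measurable]: "h \<in> borel_measurable borel" for h z
  proof -
    have "(\<integral>y. h y * \<phi> (z - y) \<partial>gaussian \<tau>) = (\<integral>y. (normal_density 0 \<tau> y * \<phi> (z - y)) * h y \<partial>lborel)"
      by (subst integral_gaussian) (auto simp: mult_ac)
    also have "\<dots> = (\<integral>y. f z * (normal_density (c * z) s y * h y) \<partial>lborel)"
      unfolding normal_density_times_kernel[OF assms] f_def s_def c_def by (simp add: mult_ac)
    finally show ?thesis by simp
  qed
  have m: "marginal (gaussian \<tau>) z = f z" for z
    using int[of "\<lambda>_. 1" z] s by (simp add: marginal_def)
  have pm: "posterior_mean (gaussian \<tau>) z = c * z" for z
    using int[of "\<lambda>y. y" z] s marginal_pos[of z]
    by (simp add: posterior_mean_def m integral_normal_moment_nz_1)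
  have v: "(\<integral>y. (y - c * z)\<^sup>2 * \<phi> (z - y) \<partial>gaussian \<tau>) = f z * c" for z
  proof -
    have "(\<integral>y. normal_density (c * z) s y * (y - c * z)\<^sup>2 \<partial>lborel) = fact 2 / (2 / s\<^sup>2)"
      using integral_normal_moment_even[OF s(1), of "c * z" 1] by simp
    also have "\<dots> = c" unfolding s(2) by (simp only: fact_2) simp
    finally show ?thesis by (subst int) simp_all
  qed
  have "ennreal (mmse (gaussian \<tau>)) = (\<integral>\<^sup>+z. ennreal (f z * c) \<partial>lborel)"
    unfolding ennreal_mmse[OF gaussian_in_P2[OF assms]] pm v ..
  also have "\<dots> = ennreal (\<integral>z. f z * c \<partial>lborel)"
    using pos by (intro nn_integral_eq_integral) (auto simp: f_def c_def)
  also have "(\<integral>z. f z * c \<partial>lborel) = c"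
    using pos by (simp add: f_def)
  finally show ?thesis
    using mmse_nonneg[OF gaussian_in_P2[OF assms]] pos by (simp add: c_def)
qed

section \<open>Lower semicontinuity of the mmse\<close>

lemma mmse_lower_semicontinuous:
  assumes Qn: "\<And>n. Qs n \<in> P2" and Q: "Q \<in> P2" and conv: "weak_conv_m Qs Q"
  shows "ennreal (mmse Q) \<le> liminf (\<lambda>n. ennreal (mmse (Qs n)))"
proof -
  interpret Q: real_distribution Q using Q by (rule P2_real_distribution)
  interpret Qs: real_distribution "Qs n" for n using Qn by (rule P2_real_distribution)
  define V where "V M z = (\<integral>y. (y - posterior_mean M z)\<^sup>2 * \<phi> (z - y) \<partial>M)" for M z
  \<comment> \<open>Second moment minus squared first moment over the mass. All three are written
    with a power y^k, so that \<open>conv'\<close> covers them at once; the quotient converges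
    because the limiting mass is a positive marginal density.\<close>
  have V: "V M z = (\<integral>y. y ^ 2 * \<phi> (z - y) \<partial>M) - (\<integral>y. y ^ 1 * \<phi> (z - y) \<partial>M)\<^sup>2 / (\<integral>y. y ^ 0 * \<phi> (z - y) \<partial>M)"
    if "real_distribution M" for M z
  proof -
    interpret real_distribution M by fact
    have "V M z = (\<integral>y. y\<^sup>2 * \<phi> (z - y) \<partial>M) - (posterior_mean M z * marginal M z)\<^sup>2 / marginal M z"
      unfolding V_def integral_square_kernel using marginal_pos[of z]
      by (simp add: power2_eq_square)
    then show ?thesis
      unfolding integral_mult_kernel[symmetric] unfolding marginal_def by simp
  qed
  have conv': "(\<lambda>n. \<integral>y. y ^ k * \<phi> (z - y) \<partial>Qs n) \<longlonglongrightarrow> (\<integral>y. y ^ k * \<phi> (z - y) \<partial>Q)" for k z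
  proof -
    obtain B where B: "\<forall>y. \<bar>y ^ k * \<phi> (z - y)\<bar> \<le> B" using bounded_moment_kernel by blast
    show ?thesis
    proof (rule weak_conv_imp_integral_bdd_continuous_conv[OF Qs.real_distribution_axioms Q.real_distribution_axioms conv])
      show "isCont (\<lambda>y. y ^ k * \<phi> (z - y)) x" for x
        unfolding std_normal_density_def by (intro continuous_intros) auto
    qed (use B in auto)
  qed
  have lim: "(\<lambda>n. V (Qs n) z) \<longlonglongrightarrow> V Q z" for z
    unfolding V[OF Q.real_distribution_axioms] V[OF Qs.real_distribution_axioms]
    using Q.marginal_pos[of z]
    by (intro tendsto_intros conv') (simp add: marginal_def)
  have [measurable]: "V (Qs n) \<in> borel_measurable borel" for n
    unfolding V_def by measurable
  have "ennreal (mmse Q) = (\<integral>\<^sup>+z. liminf (\<lambda>n. ennreal (V (Qs n) z)) \<partial>lborel)"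
    unfolding Q.ennreal_mmse[OF Q] V_def[symmetric]
    by (intro nn_integral_cong lim_imp_Liminf[symmetric] tendsto_ennrealI lim) simp
  also have "\<dots> \<le> liminf (\<lambda>n. \<integral>\<^sup>+z. ennreal (V (Qs n) z) \<partial>lborel)"
    by (intro nn_integral_liminf) simp
  also have "\<dots> = liminf (\<lambda>n. ennreal (mmse (Qs n)))"
    unfolding Qs.ennreal_mmse[OF Qn] V_def ..
  finally show ?thesis .
qed

subsection \<open>Optimal transport on the line\<close>

abbreviation unit_lebesgue :: "real measure" where
  "unit_lebesgue \<equiv> restrict_space lborel {0<..<1}"

lemma prob_space_unit_lebesgue: "prob_space unit_lebesgue"
  by (auto simp: space_restrict_space emeasure_restrict_space intro!: prob_spaceI)

lemma quantile_le_iff: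
  assumes "real_distribution Q" "0 < u" "u < 1"
  shows "quantile Q u \<le> x \<longleftrightarrow> u \<le> cdf Q x"
proof -
  interpret real_distribution Q by fact
  interpret cdf_distribution Q ..
  show ?thesis unfolding quantile_def by (rule pseudoinverse[OF assms(2,3), symmetric])
qed

lemma measurable_quantile [measurable]:
  assumes "real_distribution Q"
  shows "quantile Q \<in> borel_measurable unit_lebesgue"
proof -
  interpret real_distribution Q by fact
  interpret cdf_distribution Q ..
  have "sets unit_lebesgue = sets (restrict_space borel {0<..<1})"
    by (intro sets_restrict_space_cong) simp
  from measurable_cong_sets[OF this refl] show ?thesis
    using measurable_CI by (auto simp: quantile_def[abs_def])
qed

lemma distr_quantile:
  assumes "real_distribution Q"
  shows "distr unit_lebesgue borel (quantile Q) = Q"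
proof -
  interpret real_distribution Q by fact
  interpret cdf_distribution Q ..
  show ?thesis using distr_I_eq_M by (simp add: quantile_def[abs_def])
qed

lemma nn_integral_quantile:
  assumes "real_distribution Q" and [measurable]: "f \<in> borel_measurable borel"
  shows "(\<integral>\<^sup>+u. f (quantile Q u) \<partial>unit_lebesgue) = (\<integral>\<^sup>+x. f x \<partial>Q)"
proof -
  note [measurable] = measurable_quantile[OF assms(1)]
  have "(\<integral>\<^sup>+x. f x \<partial>distr unit_lebesgue borel (quantile Q)) = (\<integral>\<^sup>+u. f (quantile Q u) \<partial>unit_lebesgue)"
    by (rule nn_integral_distr) measurable
  then show ?thesis by (simp add: distr_quantile[OF assms(1)])
qed

section \<open>Quadratic transport cost through distribution functions\<close>

text \<open>The region x \<le> s < t < y is a right triangle with both legs y - x, so twice its area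
  is the square. Its indicator involves x and y only through the comparisons x \<le> s and t < y,
  which become events once x and y are random.\<close>

lemma square_layer_cake_aux:
  fixes x y :: real
  assumes "x \<le> y"
  shows "2 * (\<integral>\<^sup>+s. \<integral>\<^sup>+t. indicator {(s, t). s < t \<and> x \<le> s \<and> t < y} (s, t) \<partial>lborel \<partial>lborel) = ennreal ((x - y)\<^sup>2)"
proof -
  have "(\<integral>\<^sup>+t. indicator {(s, t). s < t \<and> x \<le> s \<and> t < y} (s, t) \<partial>lborel) =
      ennreal (y - s) * indicator {x..y} s" for s
  proof -
    have "(\<integral>\<^sup>+t. indicator {(s, t). s < t \<and> x \<le> s \<and> t < y} (s, t) \<partial>lborel) =
      (\<integral>\<^sup>+t. indicator {s<..<y} t * indicator {x..y} s \<partial>lborel)"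
      by (intro nn_integral_cong) (auto simp: indicator_def)
    also have "\<dots> = ennreal (y - s) * indicator {x..y} s"
      by (subst nn_integral_multc) (auto simp: indicator_def)
    finally show ?thesis .
  qed
  then have "2 * (\<integral>\<^sup>+s. \<integral>\<^sup>+t. indicator {(s, t). s < t \<and> x \<le> s \<and> t < y} (s, t) \<partial>lborel \<partial>lborel) =
      2 * (\<integral>\<^sup>+s. ennreal (y - s) * indicator {x..y} s \<partial>lborel)"
    by simp
  also have "(\<integral>\<^sup>+s. ennreal (y - s) * indicator {x..y} s \<partial>lborel) = ennreal ((- 1/2) * (y - y)\<^sup>2 - (- 1/2) * (y - x)\<^sup>2)"
  proof (rule nn_integral_FTC_Icc)
    show "DERIV (\<lambda>s. (- 1/2) * (y - s)\<^sup>2) s :> y - s" for s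
      by (rule derivative_eq_intros refl | simp add: field_simps)+
  qed (use assms in auto)
  also have "\<dots> = ennreal ((y - x)\<^sup>2 / 2)" by simp
  also have "2 * \<dots> = ennreal (2 * ((y - x)\<^sup>2 / 2))"
    by (simp add: ennreal_mult' del: times_divide_eq_right)
  also have "\<dots> = ennreal ((x - y)\<^sup>2)" by (simp add: power2_commute)
  finally show ?thesis .
qed

lemma square_layer_cake:
  fixes x y :: real
  shows "ennreal ((x - y)\<^sup>2) = 2 * (\<integral>\<^sup>+s. \<integral>\<^sup>+t. indicator {(s, t). s < t \<and> x \<le> s \<and> t < y} (s, t) +
    indicator {(s, t). s < t \<and> y \<le> s \<and> t < x} (s, t) \<partial>lborel \<partial>lborel)"
proof (cases "x \<le> y")
  case True
  then have "indicator {(s, t). s < t \<and> y \<le> s \<and> t < x} (s, t) = (0 :: ennreal)" for s t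
    by (auto simp: indicator_def)
  then show ?thesis using square_layer_cake_aux[OF True] by simp
next
  case False
  then have "indicator {(s, t). s < t \<and> x \<le> s \<and> t < y} (s, t) = (0 :: ennreal)" for s t
    by (auto simp: indicator_def)
  then show ?thesis using square_layer_cake_aux[of y x] False by (simp add: power2_commute)
qed

lemma nn_integral_square_difference:
  fixes X Y :: "'a \<Rightarrow> real"
  assumes "prob_space \<Omega>"
  assumes [measurable]: "X \<in> borel_measurable \<Omega>" "Y \<in> borel_measurable \<Omega>"
  shows "(\<integral>\<^sup>+\<omega>. ennreal ((X \<omega> - Y \<omega>)\<^sup>2) \<partial>\<Omega>) =
    2 * (\<integral>\<^sup>+s. \<integral>\<^sup>+t. indicator {(s, t). s < t} (s, t) *
      (emeasure \<Omega> {\<omega>\<in>space \<Omega>. X \<omega> \<le> s \<and> t < Y \<omega>} + emeasure \<Omega> {\<omega>\<in>space \<Omega>. Y \<omega> \<le> s \<and> t < X \<omega>}) \<partial>lborel \<partial>lborel)"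
proof -
  interpret prob_space \<Omega> by fact
  interpret pair_sigma_finite \<Omega> lborel ..
  let ?f = "\<lambda>\<omega> s t. indicator {(s, t). s < t \<and> X \<omega> \<le> s \<and> t < Y \<omega>} (s, t) +
    indicator {(s, t). s < t \<and> Y \<omega> \<le> s \<and> t < X \<omega>} (s, t) :: ennreal"
  \<comment> \<open>The conditional form is the one for which joint measurability in \<omega>, s and
    t is derived automatically, as the exchanges of integrals require.\<close>
  have f_eq: "?f \<omega> s t = (if s < t \<and> X \<omega> \<le> s \<and> t < Y \<omega> then 1 else 0) + (if s < t \<and> Y \<omega> \<le> s \<and> t < X \<omega> then 1 else 0)" for \<omega> s t
    by (simp add: indicator_def)
  have "(\<integral>\<^sup>+\<omega>. ennreal ((X \<omega> - Y \<omega>)\<^sup>2) \<partial>\<Omega>) = 2 * (\<integral>\<^sup>+\<omega>. \<integral>\<^sup>+s. \<integral>\<^sup>+t. ?f \<omega> s t \<partial>lborel \<partial>lborel \<partial>\<Omega>)"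
    unfolding square_layer_cake f_eq by (rule nn_integral_cmult) measurable
  also have "(\<integral>\<^sup>+\<omega>. \<integral>\<^sup>+s. \<integral>\<^sup>+t. ?f \<omega> s t \<partial>lborel \<partial>lborel \<partial>\<Omega>) = (\<integral>\<^sup>+s. \<integral>\<^sup>+\<omega>. \<integral>\<^sup>+t. ?f \<omega> s t \<partial>lborel \<partial>\<Omega> \<partial>lborel)"
    unfolding f_eq by (rule Fubini'[symmetric]) measurable
  also have "\<dots> = (\<integral>\<^sup>+s. \<integral>\<^sup>+t. \<integral>\<^sup>+\<omega>. ?f \<omega> s t \<partial>\<Omega> \<partial>lborel \<partial>lborel)"
    unfolding f_eq by (intro nn_integral_cong Fubini'[symmetric]) measurable
  also have "\<dots> = (\<integral>\<^sup>+s. \<integral>\<^sup>+t. indicator {(s, t). s < t} (s, t) *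
      (emeasure \<Omega> {\<omega>\<in>space \<Omega>. X \<omega> \<le> s \<and> t < Y \<omega>} + emeasure \<Omega> {\<omega>\<in>space \<Omega>. Y \<omega> \<le> s \<and> t < X \<omega>}) \<partial>lborel \<partial>lborel)"
  proof (intro nn_integral_cong)
    fix s t :: real
    have "(\<integral>\<^sup>+\<omega>. ?f \<omega> s t \<partial>\<Omega>) = (\<integral>\<^sup>+\<omega>. indicator {(s, t). s < t} (s, t) *
        (indicator {\<omega>\<in>space \<Omega>. X \<omega> \<le> s \<and> t < Y \<omega>} \<omega> + indicator {\<omega>\<in>space \<Omega>. Y \<omega> \<le> s \<and> t < X \<omega>} \<omega>) \<partial>\<Omega>)"
      by (intro nn_integral_cong) (auto simp: indicator_def)
    also have "\<dots> = indicator {(s, t). s < t} (s, t) *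
      (emeasure \<Omega> {\<omega>\<in>space \<Omega>. X \<omega> \<le> s \<and> t < Y \<omega>} + emeasure \<Omega> {\<omega>\<in>space \<Omega>. Y \<omega> \<le> s \<and> t < X \<omega>})"
      by (subst nn_integral_cmult) (simp_all add: nn_integral_add)
    finally show "(\<integral>\<^sup>+\<omega>. ?f \<omega> s t \<partial>\<Omega>) = indicator {(s, t). s < t} (s, t) *
      (emeasure \<Omega> {\<omega>\<in>space \<Omega>. X \<omega> \<le> s \<and> t < Y \<omega>} + emeasure \<Omega> {\<omega>\<in>space \<Omega>. Y \<omega> \<le> s \<and> t < X \<omega>})" .
  qed
  finally show ?thesis .
qed

text \<open>Here \<open>ennreal\<close> takes positive parts, and \<open>(F s - G t)\<^sup>+\<close> is the least mass that a coupling can put on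
  \<open>{X \<le> s, t < Y}\<close>.\<close>

definition cdf_cost :: "real measure \<Rightarrow> real measure \<Rightarrow> ennreal" where
  "cdf_cost P Q = 2 * (\<integral>\<^sup>+s. \<integral>\<^sup>+t. indicator {(s, t). s < t} (s, t) *
     (ennreal (cdf P s - cdf Q t) + ennreal (cdf Q s - cdf P t)) \<partial>lborel \<partial>lborel)"

text \<open>If A \<le> s, then either t < B or B \<le> t. Hence the event {A \<le> s, t < B} has
  probability at least the difference of the two distribution functions, whatever the
  coupling.\<close>

lemma cdf_cost_le:
  fixes X Y :: "'a \<Rightarrow> real"
  assumes "prob_space \<Omega>"
  assumes [measurable]: "X \<in> borel_measurable \<Omega>" "Y \<in> borel_measurable \<Omega>"
  shows "cdf_cost (distr \<Omega> borel X) (distr \<Omega> borel Y) \<le> (\<integral>\<^sup>+\<omega>. ennreal ((X \<omega> - Y \<omega>)\<^sup>2) \<partial>\<Omega>)"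
proof -
  interpret prob_space \<Omega> by fact
  have *: "ennreal (cdf (distr \<Omega> borel A) s - cdf (distr \<Omega> borel B) t) \<le> emeasure \<Omega> {\<omega>\<in>space \<Omega>. A \<omega> \<le> s \<and> t < B \<omega>}"
    if [measurable]: "A \<in> borel_measurable \<Omega>" "B \<in> borel_measurable \<Omega>" for A B :: "'a \<Rightarrow> real" and s t
  proof -
    have "prob {\<omega>\<in>space \<Omega>. A \<omega> \<le> s} \<le> prob ({\<omega>\<in>space \<Omega>. A \<omega> \<le> s \<and> t < B \<omega>} \<union> {\<omega>\<in>space \<Omega>. B \<omega> \<le> t})"
      by (intro finite_measure_mono) auto
    also have "\<dots> \<le> prob {\<omega>\<in>space \<Omega>. A \<omega> \<le> s \<and> t < B \<omega>} + prob {\<omega>\<in>space \<Omega>. B \<omega> \<le> t}"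
      by (intro measure_Un_le) auto
    finally have "prob {\<omega>\<in>space \<Omega>. A \<omega> \<le> s} - prob {\<omega>\<in>space \<Omega>. B \<omega> \<le> t} \<le> prob {\<omega>\<in>space \<Omega>. A \<omega> \<le> s \<and> t < B \<omega>}"
      by simp
    moreover have "cdf (distr \<Omega> borel C) r = prob {\<omega>\<in>space \<Omega>. C \<omega> \<le> r}" if [measurable]: "C \<in> borel_measurable \<Omega>" for C r
      unfolding cdf_def by (subst measure_distr) (auto intro!: arg_cong[where f=prob])
    ultimately show ?thesis by (simp add: emeasure_eq_measure ennreal_leI)
  qed
  show ?thesis
    unfolding cdf_cost_def nn_integral_square_difference[OF assms]
    by (intro mult_left_mono nn_integral_mono add_mono *) auto
qed

text \<open>Under the quantile coupling the event {X \<le> s, t < Y} is the set of u in the interval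
  (G(t), F(s)], whose length is exactly the positive part of F(s) - G(t). The lower bound valid for
  all couplings is therefore attained.\<close>

lemma cdf_cost_eq_quantile:
  assumes P: "real_distribution P" and Q: "real_distribution Q"
  shows "(\<integral>\<^sup>+u. ennreal ((quantile P u - quantile Q u)\<^sup>2) \<partial>unit_lebesgue) = cdf_cost P Q"
proof -
  note [measurable] = measurable_quantile[OF P] measurable_quantile[OF Q]
  have *: "emeasure unit_lebesgue {u\<in>space unit_lebesgue. quantile A u \<le> s \<and> t < quantile B u} = ennreal (cdf A s - cdf B t)"
    if A: "real_distribution A" and B: "real_distribution B" for A B s t
  proof -
    interpret A: real_distribution A by fact
    interpret B: real_distribution B by fact
    have set_eq: "{u\<in>space unit_lebesgue. quantile A u \<le> s \<and> t < quantile B u} = {0<..<1} \<inter> {cdf B t<..cdf A s}"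
      using quantile_le_iff[OF A] quantile_le_iff[OF B]
      by (auto simp: space_restrict_space not_le[symmetric])
    have "emeasure unit_lebesgue {u\<in>space unit_lebesgue. quantile A u \<le> s \<and> t < quantile B u} =
        emeasure lborel ({0<..<1} \<inter> {cdf B t<..cdf A s})"
      unfolding set_eq by (subst emeasure_restrict_space) (auto simp: Int_ac)
    also have "\<dots> = ennreal (cdf A s - cdf B t)"
    \<comment> \<open>Intersecting with (0, 1) can remove only an endpoint, since distribution
      functions take values in [0, 1]; the open interval supplies the lower bound.\<close>
    proof (rule antisym)
      have "emeasure lborel ({0<..<1} \<inter> {cdf B t<..cdf A s}) \<le> emeasure lborel {cdf B t<..cdf A s}"
        by (intro emeasure_mono) auto
      also have "\<dots> = ennreal (cdf A s - cdf B t)"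
        by (cases "cdf B t \<le> cdf A s") (auto simp: ennreal_neg)
      finally show "emeasure lborel ({0<..<1} \<inter> {cdf B t<..cdf A s}) \<le> ennreal (cdf A s - cdf B t)" .
      have "ennreal (cdf A s - cdf B t) = emeasure lborel {cdf B t<..<cdf A s}"
        by (cases "cdf B t \<le> cdf A s") (auto simp: ennreal_neg)
      also have "\<dots> \<le> emeasure lborel ({0<..<1} \<inter> {cdf B t<..cdf A s})"
      proof (intro emeasure_mono subsetI)
        fix u assume "u \<in> {cdf B t<..<cdf A s}"
        then show "u \<in> {0<..<1} \<inter> {cdf B t<..cdf A s}"
          using B.cdf_nonneg[of t] A.cdf_bounded_prob[of s] by auto
      qed auto
      finally show "ennreal (cdf A s - cdf B t) \<le> emeasure lborel ({0<..<1} \<inter> {cdf B t<..cdf A s})" .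
    qed
    finally show ?thesis .
  qed
  show ?thesis
    unfolding cdf_cost_def
      nn_integral_square_difference[OF prob_space_unit_lebesgue measurable_quantile[OF P] measurable_quantile[OF Q]]
      *[OF P Q] *[OF Q P] ..
qed

lemma integrable_quantile_P2:
  assumes "Q \<in> P2"
  shows "integrable unit_lebesgue (\<lambda>u. (quantile Q u)\<^sup>2)"
    and "(\<integral>u. (quantile Q u)\<^sup>2 \<partial>unit_lebesgue) = (\<integral>x. x\<^sup>2 \<partial>Q)"
proof -
  have Q: "real_distribution Q" using assms by (rule P2_real_distribution)
  note [measurable] = measurable_quantile[OF Q]
  have "integrable (distr unit_lebesgue borel (quantile Q)) (\<lambda>x. x\<^sup>2)"
    using assms by (simp add: distr_quantile[OF Q] P2_def)
  then show "integrable unit_lebesgue (\<lambda>u. (quantile Q u)\<^sup>2)"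
    by (rule integrable_distr[rotated]) measurable
  have "(\<integral>x. x\<^sup>2 \<partial>distr unit_lebesgue borel (quantile Q)) = (\<integral>u. (quantile Q u)\<^sup>2 \<partial>unit_lebesgue)"
    by (rule integral_distr) auto
  then show "(\<integral>u. (quantile Q u)\<^sup>2 \<partial>unit_lebesgue) = (\<integral>x. x\<^sup>2 \<partial>Q)"
    by (simp add: distr_quantile[OF Q])
qed

lemma square_diff_le: "(a - b)\<^sup>2 \<le> 2 * a\<^sup>2 + 2 * (b :: real)\<^sup>2"
  using zero_le_power2[of "a + b"] by (simp add: power2_diff power2_sum)

lemma integrable_square_diff:
  fixes X Y :: "'a \<Rightarrow> real"
  assumes [measurable]: "X \<in> borel_measurable M" "Y \<in> borel_measurable M"
    and "integrable M (\<lambda>\<omega>. (X \<omega>)\<^sup>2)" "integrable M (\<lambda>\<omega>. (Y \<omega>)\<^sup>2)"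
  shows "integrable M (\<lambda>\<omega>. (X \<omega> - Y \<omega>)\<^sup>2)"
proof (rule Bochner_Integration.integrable_bound)
  show "integrable M (\<lambda>\<omega>. 2 * (X \<omega>)\<^sup>2 + 2 * (Y \<omega>)\<^sup>2)" using assms by simp
  show "AE \<omega> in M. norm ((X \<omega> - Y \<omega>)\<^sup>2) \<le> norm (2 * (X \<omega>)\<^sup>2 + 2 * (Y \<omega>)\<^sup>2)"
    using square_diff_le by auto
qed measurable

lemma couplingD:
  assumes "\<pi> \<in> couplings P Q" and P: "P \<in> P2" and Q: "Q \<in> P2"
  shows "prob_space \<pi>" "fst \<in> borel_measurable \<pi>" "snd \<in> borel_measurable \<pi>"
    "integrable \<pi> (\<lambda>z. (fst z - snd z)\<^sup>2)"
proof -
  have sets[measurable_cong]: "sets \<pi> = sets (borel \<Otimes>\<^sub>M borel)" and d: "distr \<pi> borel fst = P" "distr \<pi> borel snd = Q"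
    using assms(1) by (auto simp: couplings_def)
  show m[measurable]: "fst \<in> borel_measurable \<pi>" "snd \<in> borel_measurable \<pi>" by measurable
  interpret P: real_distribution P using P by (rule P2_real_distribution)
  show "prob_space \<pi>"
    using m(1) d(1) P.prob_space_axioms by (intro prob_space_distrD[of fst \<pi> borel]) auto
  have "integrable \<pi> (\<lambda>z. (fst z)\<^sup>2)" "integrable \<pi> (\<lambda>z. (snd z)\<^sup>2)"
    using P Q d integrable_distr[of fst \<pi> borel "\<lambda>x. x\<^sup>2"] integrable_distr[of snd \<pi> borel "\<lambda>x. x\<^sup>2"]
    by (auto simp: P2_def)
  then show "integrable \<pi> (\<lambda>z. (fst z - snd z)\<^sup>2)"
    by (intro integrable_square_diff) auto
qed

lemma W2_sq_eq_quantile: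
  assumes P: "P \<in> P2" and Q: "Q \<in> P2"
  shows "W2_sq P Q = (\<integral>u. (quantile P u - quantile Q u)\<^sup>2 \<partial>unit_lebesgue)"
proof -
  have rd: "real_distribution P" "real_distribution Q" using P Q by (auto dest: P2_real_distribution)
  interpret U: prob_space unit_lebesgue by (rule prob_space_unit_lebesgue)
  note [measurable] = measurable_quantile[OF rd(1)] measurable_quantile[OF rd(2)]
  let ?\<pi> = "distr unit_lebesgue (borel \<Otimes>\<^sub>M borel) (\<lambda>u. (quantile P u, quantile Q u))"
  have i: "integrable unit_lebesgue (\<lambda>u. (quantile P u - quantile Q u)\<^sup>2)"
    using P Q by (intro integrable_square_diff integrable_quantile_P2) auto
  have c: "?\<pi> \<in> couplings P Q"
    by (auto simp: couplings_def distr_distr o_def distr_quantile rd)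
  have e: "(\<integral>z. (fst z - snd z)\<^sup>2 \<partial>?\<pi>) = (\<integral>u. (quantile P u - quantile Q u)\<^sup>2 \<partial>unit_lebesgue)"
    by (subst integral_distr) auto
  have "(\<integral>u. (quantile P u - quantile Q u)\<^sup>2 \<partial>unit_lebesgue) \<le> (\<integral>z. (fst z - snd z)\<^sup>2 \<partial>\<pi>)"
    if "\<pi> \<in> couplings P Q" for \<pi>
  proof -
    note \<pi> = couplingD[OF that P Q]
    have "ennreal (\<integral>u. (quantile P u - quantile Q u)\<^sup>2 \<partial>unit_lebesgue) = cdf_cost P Q"
      using i cdf_cost_eq_quantile[OF rd] by (simp add: nn_integral_eq_integral)
    also have "\<dots> \<le> (\<integral>\<^sup>+z. ennreal ((fst z - snd z)\<^sup>2) \<partial>\<pi>)"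
      using cdf_cost_le[OF \<pi>(1-3)] that by (simp add: couplings_def)
    also have "\<dots> = ennreal (\<integral>z. (fst z - snd z)\<^sup>2 \<partial>\<pi>)"
      using \<pi>(4) by (simp add: nn_integral_eq_integral)
    finally show ?thesis by (simp add: ennreal_le_iff)
  qed
  then show ?thesis
    unfolding W2_sq_def e[symmetric] using c by (intro cInf_eq_minimum) auto
qed

lemma ennreal_W2_sq:
  assumes P: "P \<in> P2" and Q: "Q \<in> P2"
  shows "ennreal (W2_sq P Q) = cdf_cost P Q"
proof -
  have rd: "real_distribution P" "real_distribution Q" using P Q by (auto dest: P2_real_distribution)
  note [measurable] = measurable_quantile[OF rd(1)] measurable_quantile[OF rd(2)]
  have i: "integrable unit_lebesgue (\<lambda>u. (quantile P u - quantile Q u)\<^sup>2)"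
    using P Q by (intro integrable_square_diff integrable_quantile_P2) auto
  show ?thesis
    using nn_integral_eq_integral[OF i] cdf_cost_eq_quantile[OF rd] by (simp add: W2_sq_eq_quantile[OF P Q])
qed

lemma W2_sq_nonneg: "P \<in> P2 \<Longrightarrow> Q \<in> P2 \<Longrightarrow> 0 \<le> W2_sq P Q"
  by (simp add: W2_sq_eq_quantile)

lemma W2_sq_le_second_moments:
  assumes P: "P \<in> P2" and Q: "Q \<in> P2"
  shows "W2_sq P Q \<le> 2 * (\<integral>x. x\<^sup>2 \<partial>P) + 2 * (\<integral>x. x\<^sup>2 \<partial>Q)"
proof -
  have rd: "real_distribution P" "real_distribution Q" using P Q by (auto dest: P2_real_distribution)
  note [measurable] = measurable_quantile[OF rd(1)] measurable_quantile[OF rd(2)]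
  note iP = integrable_quantile_P2[OF P] and iQ = integrable_quantile_P2[OF Q]
  have "W2_sq P Q \<le> (\<integral>u. 2 * (quantile P u)\<^sup>2 + 2 * (quantile Q u)\<^sup>2 \<partial>unit_lebesgue)"
    unfolding W2_sq_eq_quantile[OF P Q]
    using iP(1) iQ(1) square_diff_le by (intro integral_mono integrable_square_diff) auto
  also have "\<dots> = 2 * (\<integral>x. x\<^sup>2 \<partial>P) + 2 * (\<integral>x. x\<^sup>2 \<partial>Q)"
    using iP iQ by simp
  finally show ?thesis .
qed

lemma second_moment_le_W2_sq:
  assumes P: "P \<in> P2" and Q: "Q \<in> P2"
  shows "(\<integral>x. x\<^sup>2 \<partial>Q) \<le> 2 * (\<integral>x. x\<^sup>2 \<partial>P) + 2 * W2_sq P Q"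
proof -
  have rd: "real_distribution P" "real_distribution Q" using P Q by (auto dest: P2_real_distribution)
  note [measurable] = measurable_quantile[OF rd(1)] measurable_quantile[OF rd(2)]
  note iP = integrable_quantile_P2[OF P] and iQ = integrable_quantile_P2[OF Q]
  have i: "integrable unit_lebesgue (\<lambda>u. (quantile P u - quantile Q u)\<^sup>2)"
    using P Q by (intro integrable_square_diff integrable_quantile_P2) auto
  have "(\<integral>x. x\<^sup>2 \<partial>Q) \<le> (\<integral>u. 2 * (quantile P u)\<^sup>2 + 2 * (quantile P u - quantile Q u)\<^sup>2 \<partial>unit_lebesgue)"
    unfolding iQ(2)[symmetric]
  proof (rule integral_mono)
    show "(quantile Q u)\<^sup>2 \<le> 2 * (quantile P u)\<^sup>2 + 2 * (quantile P u - quantile Q u)\<^sup>2" for u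
      using square_diff_le[of "quantile P u" "quantile P u - quantile Q u"] by simp
  qed (use iP(1) iQ(1) i in auto)
  also have "\<dots> = 2 * (\<integral>x. x\<^sup>2 \<partial>P) + 2 * W2_sq P Q"
    using iP i by (simp add: W2_sq_eq_quantile[OF P Q])
  finally show ?thesis .
qed

text \<open>Meant for weak limits, whose second moment is not known in advance:
  \<open>cdf_cost\<close> makes sense for every law, and its finiteness puts the limit back into
  \<open>P2\<close>.\<close>

lemma P2_if_cdf_cost_finite:
  assumes P: "P \<in> P2" and Q: "real_distribution Q" and fin: "cdf_cost P Q < \<infinity>"
  shows "Q \<in> P2"
proof -
  have rd: "real_distribution P" using P by (rule P2_real_distribution)
  interpret Q: real_distribution Q by fact
  note [measurable] = measurable_quantile[OF rd(1)] measurable_quantile[OF Q]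
  have "(\<integral>\<^sup>+x. ennreal (x\<^sup>2) \<partial>Q) = (\<integral>\<^sup>+u. ennreal ((quantile Q u)\<^sup>2) \<partial>unit_lebesgue)"
    by (rule nn_integral_quantile[symmetric, OF Q]) measurable
  also have "\<dots> \<le> (\<integral>\<^sup>+u. 2 * ennreal ((quantile P u)\<^sup>2) + 2 * ennreal ((quantile P u - quantile Q u)\<^sup>2) \<partial>unit_lebesgue)"
  proof (rule nn_integral_mono)
    fix u
    have "ennreal ((quantile Q u)\<^sup>2) \<le> ennreal (2 * (quantile P u)\<^sup>2 + 2 * (quantile P u - quantile Q u)\<^sup>2)"
      using square_diff_le[of "quantile P u" "quantile P u - quantile Q u"] by (intro ennreal_leI) simp
    then show "ennreal ((quantile Q u)\<^sup>2) \<le> 2 * ennreal ((quantile P u)\<^sup>2) + 2 * ennreal ((quantile P u - quantile Q u)\<^sup>2)"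
      by (simp add: ennreal_mult)
  qed
  also have "\<dots> = 2 * ennreal (\<integral>x. x\<^sup>2 \<partial>P) + 2 * cdf_cost P Q"
    using integrable_quantile_P2[OF P]
    by (simp add: nn_integral_add nn_integral_cmult cdf_cost_eq_quantile[OF rd Q] nn_integral_eq_integral)
  also have "\<dots> < \<infinity>" using fin by (simp add: ennreal_mult_less_top)
  finally have "integrable Q (\<lambda>x. x\<^sup>2)" by (intro integrableI_nonneg) auto
  then show ?thesis using Q by (simp add: P2_def)
qed

text \<open>Weak convergence gives convergence of distribution functions at continuity points of the
  limit. The remaining points are countable, hence Lebesgue null, and Fatou is applied once for each
  of the two integrals.\<close>

lemma cdf_cost_lower_semicontinuous:
  assumes P: "real_distribution P" and Qn: "\<And>n. real_distribution (Qs n)" and Q: "real_distribution Q"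
    and conv: "weak_conv_m Qs Q"
  shows "cdf_cost P Q \<le> liminf (\<lambda>n. cdf_cost P (Qs n))"
proof -
  interpret P: real_distribution P by fact
  interpret Q: real_distribution Q by fact
  interpret Qs: real_distribution "Qs n" for n by fact
  have [measurable]: "cdf M \<in> borel_measurable borel" if "real_distribution M" for M
    using cdf_distribution.measurable_C[unfolded cdf_distribution_def, OF that] .
  note [measurable] = this[OF P] this[OF Q] this[OF Qn]
  define k where "k M s t = indicator {(s, t). s < t} (s, t) *
     (ennreal (cdf P s - cdf M t) + ennreal (cdf M s - cdf P t))" for M s t
  have k_eq: "k M s t = (if s < t then 1 else 0) * (ennreal (cdf P s - cdf M t) + ennreal (cdf M s - cdf P t))" for M s t
    by (simp add: k_def indicator_def)
  have "countable {x. measure Q {x} > 0}" by (rule Q.countable_atoms)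
  then have "{x. measure Q {x} > 0} \<in> null_sets lborel"
    by (rule countable_imp_null_set_lborel)
  then have AE: "AE x in lborel. isCont (cdf Q) x"
    by (rule AE_I'[of _ lborel]) (auto simp: Q.isCont_cdf zero_less_measure_iff)
  have lim: "(\<lambda>n. k (Qs n) s t) \<longlonglongrightarrow> k Q s t" if "isCont (cdf Q) s" "isCont (cdf Q) t" for s t
    unfolding k_eq using conv that
    by (intro tendsto_intros tendsto_mult_ennreal) (auto simp: weak_conv_m_def weak_conv_def)
  have "(\<integral>\<^sup>+s. \<integral>\<^sup>+t. k Q s t \<partial>lborel \<partial>lborel) \<le> (\<integral>\<^sup>+s. liminf (\<lambda>n. \<integral>\<^sup>+t. k (Qs n) s t \<partial>lborel) \<partial>lborel)"
  proof (rule nn_integral_mono_AE)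
    show "AE s in lborel. (\<integral>\<^sup>+t. k Q s t \<partial>lborel) \<le> liminf (\<lambda>n. \<integral>\<^sup>+t. k (Qs n) s t \<partial>lborel)"
      using AE
    proof eventually_elim
      case (elim s)
      have "(\<integral>\<^sup>+t. k Q s t \<partial>lborel) = (\<integral>\<^sup>+t. liminf (\<lambda>n. k (Qs n) s t) \<partial>lborel)"
      proof (rule nn_integral_cong_AE)
        show "AE t in lborel. k Q s t = liminf (\<lambda>n. k (Qs n) s t)"
          using AE by eventually_elim (use lim_imp_Liminf[OF _ lim[OF elim]] in auto)
      qed
      also have "\<dots> \<le> liminf (\<lambda>n. \<integral>\<^sup>+t. k (Qs n) s t \<partial>lborel)"
        unfolding k_eq by (rule nn_integral_liminf) measurable
      finally show ?case .
    qed
  qed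
  also have "\<dots> \<le> liminf (\<lambda>n. \<integral>\<^sup>+s. \<integral>\<^sup>+t. k (Qs n) s t \<partial>lborel \<partial>lborel)"
    unfolding k_eq by (rule nn_integral_liminf) measurable
  finally have "2 * (\<integral>\<^sup>+s. \<integral>\<^sup>+t. k Q s t \<partial>lborel \<partial>lborel) \<le> 2 * liminf (\<lambda>n. \<integral>\<^sup>+s. \<integral>\<^sup>+t. k (Qs n) s t \<partial>lborel \<partial>lborel)"
    by (rule mult_left_mono) simp
  also have "\<dots> = liminf (\<lambda>n. 2 * (\<integral>\<^sup>+s. \<integral>\<^sup>+t. k (Qs n) s t \<partial>lborel \<partial>lborel))"
    by (rule Liminf_compose_continuous_mono[symmetric])
       (auto intro!: ennreal_continuous_on_cmult continuous_on_id mult_left_mono simp: mono_def)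
  finally show ?thesis by (simp add: cdf_cost_def k_def)
qed

section \<open>Gaussian quantiles and the controller\<close>

lemma measure_gaussian_pos:
  assumes "0 < \<tau>" and [measurable]: "A \<in> sets borel" and "emeasure lborel A \<noteq> 0"
  shows "0 < measure (gaussian \<tau>) A"
proof -
  interpret real_distribution "gaussian \<tau>" using assms(1) by (rule real_distribution_gaussian)
  have "emeasure (gaussian \<tau>) A \<noteq> 0"
  proof
    assume "emeasure (gaussian \<tau>) A = 0"
    then have "A \<in> null_sets (gaussian \<tau>)" by auto
    then have "AE x in lborel. x \<in> A \<longrightarrow> ennreal (normal_density 0 \<tau> x) = 0"
      unfolding gaussian_def by (subst (asm) null_sets_density_iff) auto
    then have "AE x in lborel. x \<notin> A"
    proof eventually_elim
      case (elim x)
      then show ?case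
        using normal_density_pos[OF assms(1), of 0 x] by (auto simp: ennreal_eq_0_iff)
    qed
    then have "A \<in> null_sets lborel" by (subst AE_iff_null_sets) auto
    then show False using assms(3) by auto
  qed
  then show ?thesis by (simp add: emeasure_eq_measure zero_less_measure_iff)
qed

text \<open>Ensures that \<open>controller\<close> evaluates \<open>quantile\<close> strictly inside
  (0, 1), where the infimum is meaningful.\<close>

lemma cdf_gaussian_bounds:
  assumes "0 < \<tau>"
  shows "0 < cdf (gaussian \<tau>) x" "cdf (gaussian \<tau>) x < 1"
proof -
  interpret real_distribution "gaussian \<tau>" using assms by (rule real_distribution_gaussian)
  have "emeasure lborel {x - 1..x} \<noteq> 0" "emeasure lborel {x<..x + 1} \<noteq> 0" by auto
  then have pos: "0 < prob {x - 1..x}" "0 < prob {x<..x + 1}"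
    by (auto intro!: measure_gaussian_pos[OF assms])
  have "prob {x - 1..x} \<le> prob {..x}"
    by (intro finite_measure_mono) auto
  with pos(1) show "0 < cdf (gaussian \<tau>) x" by (simp add: cdf_def)
  have "prob {..x} + prob {x<..x + 1} = prob ({..x} \<union> {x<..x + 1})"
    by (intro finite_measure_Union[symmetric]) auto
  also have "\<dots> \<le> 1" by simp
  finally show "cdf (gaussian \<tau>) x < 1" using pos(2) by (simp add: cdf_def)
qed

lemma isCont_cdf_gaussian:
  assumes "0 < \<tau>"
  shows "isCont (cdf (gaussian \<tau>)) x"
proof -
  interpret real_distribution "gaussian \<tau>" using assms by (rule real_distribution_gaussian)
  have "AE y in lborel. y \<in> {x} \<longrightarrow> ennreal (normal_density 0 \<tau> y) = 0"
    using AE_lborel_singleton[of x] by eventually_elim simp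
  then have "{x} \<in> null_sets (gaussian \<tau>)"
    unfolding gaussian_def by (subst null_sets_density_iff) auto
  then show ?thesis by (auto simp: isCont_cdf measure_def)
qed

text \<open>To the left of the quantile the distribution function is at most u; continuity there
  excludes a jump above u.\<close>

lemma cdf_quantile:
  assumes Q: "real_distribution Q" and u: "0 < u" "u < 1" and cont: "isCont (cdf Q) (quantile Q u)"
  shows "cdf Q (quantile Q u) = u"
proof (rule antisym)
  show "u \<le> cdf Q (quantile Q u)"
    using quantile_le_iff[OF Q u] by blast
  have "cdf Q x \<le> u" if "x < quantile Q u" for x
    using quantile_le_iff[OF Q u, of x] that by linarith
  then have "eventually (\<lambda>x. cdf Q x \<le> u) (at_left (quantile Q u))"
    by (auto simp: eventually_at_left_field intro!: exI[of _ "quantile Q u - 1"])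
  moreover have "(cdf Q \<longlongrightarrow> cdf Q (quantile Q u)) (at_left (quantile Q u))"
    using cont by (simp add: continuous_at continuous_within filterlim_at_split)
  ultimately show "cdf Q (quantile Q u) \<le> u"
    by (intro tendsto_upperbound[where F="at_left (quantile Q u)"]) auto
qed

text \<open>Substituting x = F_P^{-1}(u) turns the controller into the quantile of \<open>Q\<close>
  at u, because F_P is continuous. The squared L^2 distance from the identity is thus the cost of
  the quantile coupling, which is optimal.\<close>

lemma nn_integral_controller:
  assumes \<sigma>: "0 < \<sigma>" and Q: "Q \<in> P2"
  shows "(\<integral>\<^sup>+x. ennreal ((controller (gaussian \<sigma>) Q x - x)\<^sup>2) \<partial>gaussian \<sigma>) = ennreal (W2_sq (gaussian \<sigma>) Q)"
proof -
  let ?P = "gaussian \<sigma>"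
  have P: "real_distribution ?P" "?P \<in> P2" using \<sigma> by (auto intro: real_distribution_gaussian gaussian_in_P2)
  have rdQ: "real_distribution Q" using Q by (rule P2_real_distribution)
  interpret P: real_distribution ?P by (rule P)
  \<comment> \<open>Monotonicity serves to establish Borel measurability.\<close>
  have "mono (controller ?P Q)"
  proof (rule monoI)
    fix x y :: real assume "x \<le> y"
    then have le: "cdf ?P x \<le> cdf ?P y" by (rule P.cdf_nondecreasing)
    have "cdf ?P y \<le> cdf Q (quantile Q (cdf ?P y))"
      using quantile_le_iff[OF rdQ cdf_gaussian_bounds[OF \<sigma>], of y] by blast
    with le have "cdf ?P x \<le> cdf Q (quantile Q (cdf ?P y))" by linarith
    then show "controller ?P Q x \<le> controller ?P Q y"
      using quantile_le_iff[OF rdQ cdf_gaussian_bounds[OF \<sigma>], of x] by (simp add: controller_def)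
  qed
  then have [measurable]: "controller ?P Q \<in> borel_measurable borel"
    by (rule borel_measurable_mono)
  have "(\<integral>\<^sup>+x. ennreal ((controller ?P Q x - x)\<^sup>2) \<partial>?P) =
      (\<integral>\<^sup>+u. ennreal ((controller ?P Q (quantile ?P u) - quantile ?P u)\<^sup>2) \<partial>unit_lebesgue)"
    by (rule nn_integral_quantile[OF P(1), symmetric]) measurable
  also have "\<dots> = (\<integral>\<^sup>+u. ennreal ((quantile ?P u - quantile Q u)\<^sup>2) \<partial>unit_lebesgue)"
  proof (rule nn_integral_cong)
    fix u assume "u \<in> space unit_lebesgue"
    then have "0 < u" "u < 1" by (auto simp: space_restrict_space)
    then have "controller ?P Q (quantile ?P u) = quantile Q u"
      using cdf_quantile[OF P(1) _ _ isCont_cdf_gaussian[OF \<sigma>]] by (simp add: controller_def)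
    then show "ennreal ((controller ?P Q (quantile ?P u) - quantile ?P u)\<^sup>2) = ennreal ((quantile ?P u - quantile Q u)\<^sup>2)"
      by (simp add: power2_commute)
  qed
  finally show ?thesis
    by (simp add: cdf_cost_eq_quantile[OF P(1) rdQ] ennreal_W2_sq[OF P(2) Q])
qed

lemma distr_scale_gaussian:
  assumes "0 < \<tau>"
  shows "distr (gaussian 1) borel (\<lambda>x. \<tau> * x) = gaussian \<tau>"
proof -
  interpret real_distribution "gaussian 1" by (rule real_distribution_gaussian) simp
  have "distr (gaussian 1) lborel (\<lambda>x. x) = gaussian 1"
    by (intro distr_id2) (simp add: gaussian_def)
  then have "distributed (gaussian 1) lborel (\<lambda>x. x) (\<lambda>x. ennreal (normal_density 0 1 x))"
    by (simp add: distributed_def gaussian_def)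
  from normal_density_affine[OF this, of \<tau> 0] assms
  have "distributed (gaussian 1) lborel (\<lambda>x. \<tau> * x) (\<lambda>x. ennreal (normal_density 0 \<tau> x))"
    by simp
  then have "distr (gaussian 1) lborel (\<lambda>x. \<tau> * x) = gaussian \<tau>"
    by (simp add: distributed_def gaussian_def)
  moreover have "distr (gaussian 1) borel (\<lambda>x. \<tau> * x) = distr (gaussian 1) lborel (\<lambda>x. \<tau> * x)"
    by (rule distr_cong) auto
  ultimately show ?thesis by simp
qed

lemma quantile_gaussian:
  assumes \<tau>: "0 < \<tau>" and u: "0 < u" "u < 1"
  shows "quantile (gaussian \<tau>) u = \<tau> * quantile (gaussian 1) u"
proof -
  have 1: "real_distribution (gaussian 1)" by (rule real_distribution_gaussian) simp
  have cdf: "cdf (gaussian \<tau>) x = cdf (gaussian 1) (x / \<tau>)" for x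
  proof -
    have "(\<lambda>y. \<tau> * y) -` {..x} = {..x / \<tau>}"
      using \<tau> by (auto simp: field_simps)
    then show ?thesis
      unfolding cdf_def distr_scale_gaussian[OF \<tau>, symmetric]
      by (subst measure_distr) (auto simp: gaussian_def)
  qed
  have "quantile (gaussian \<tau>) u \<le> x \<longleftrightarrow> \<tau> * quantile (gaussian 1) u \<le> x" for x
  proof -
    have "quantile (gaussian \<tau>) u \<le> x \<longleftrightarrow> quantile (gaussian 1) u \<le> x / \<tau>"
      by (simp add: quantile_le_iff[OF real_distribution_gaussian[OF \<tau>] u] quantile_le_iff[OF 1 u] cdf)
    also have "\<dots> \<longleftrightarrow> \<tau> * quantile (gaussian 1) u \<le> x"
      using \<tau> by (simp add: field_simps)
    finally show ?thesis .
  qed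
  then show ?thesis by (meson order_antisym order_refl)
qed

text \<open>The quantile functions are \<sigma> and \<tau> times that of N(0, 1), whose second
  moment is 1.\<close>

lemma W2_sq_gaussian:
  assumes \<sigma>: "0 < \<sigma>" and \<tau>: "0 < \<tau>"
  shows "W2_sq (gaussian \<sigma>) (gaussian \<tau>) = (\<sigma> - \<tau>)\<^sup>2"
proof -
  have 1: "gaussian 1 \<in> P2" by (rule gaussian_in_P2) simp
  have "W2_sq (gaussian \<sigma>) (gaussian \<tau>) =
      (\<integral>u. (\<sigma> - \<tau>)\<^sup>2 * (quantile (gaussian 1) u)\<^sup>2 \<partial>unit_lebesgue)"
    unfolding W2_sq_eq_quantile[OF gaussian_in_P2[OF \<sigma>] gaussian_in_P2[OF \<tau>]]
    by (rule Bochner_Integration.integral_cong)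
       (auto simp: space_restrict_space quantile_gaussian[OF \<sigma>] quantile_gaussian[OF \<tau>]
         simp flip: left_diff_distrib power_mult_distrib)
  also have "\<dots> = (\<sigma> - \<tau>)\<^sup>2"
    using integrable_quantile_P2[OF 1] by (simp add: integral_gaussian_square)
  finally show ?thesis .
qed

subsection \<open>Minimizers and the effect of a small displacement\<close>

lemma cost_nonneg: "P \<in> P2 \<Longrightarrow> Q \<in> P2 \<Longrightarrow> 0 \<le> cost P k Q"
  by (simp add: cost_def W2_sq_nonneg mmse_nonneg)

lemma J_star_le_cost:
  assumes "P \<in> P2" "Q \<in> P2"
  shows "J_star P k \<le> cost P k Q"
  unfolding J_star_def using assms
  by (intro cINF_lower bdd_belowI2[of _ 0] cost_nonneg)

lemma J_star_nonneg:
  assumes "P \<in> P2"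
  shows "0 \<le> J_star P k"
  unfolding J_star_def using assms cost_nonneg by (intro cINF_greatest) auto

lemma J_star_mono:
  assumes "P \<in> P2" "0 \<le> k" "k \<le> l"
  shows "J_star P k \<le> J_star P l"
proof -
  have "J_star P k \<le> cost P l Q" if "Q \<in> P2" for Q
  proof -
    have "J_star P k \<le> cost P k Q" using assms that by (intro J_star_le_cost)
    also have "\<dots> \<le> cost P l Q"
      using assms that unfolding cost_def
      by (intro add_right_mono mult_right_mono power_mono W2_sq_nonneg)
    finally show ?thesis .
  qed
  then show ?thesis
    unfolding J_star_def[of P l] using assms(1) by (intro cINF_greatest) auto
qed

section \<open>Existence of minimizers\<close>

text \<open>Brings semicontinuity back to real inequalities. Negative c is treated apart because
  \<open>ennreal\<close> sends it to 0, where strictness could be lost.\<close>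

lemma eventually_less_if_ennreal_le_liminf:
  fixes a :: "nat \<Rightarrow> real"
  assumes "ennreal x \<le> liminf (\<lambda>n. ennreal (a n))" "\<And>n. 0 \<le> a n" "c < x"
  shows "eventually (\<lambda>n. c < a n) sequentially"
proof (cases "0 \<le> c")
  case True
  then have "ennreal c < ennreal x" using assms(3) by (simp add: ennreal_less_iff)
  also note assms(1)
  finally show ?thesis
    using True by (auto dest!: less_LiminfD simp: ennreal_less_iff elim: eventually_mono)
next
  case False
  then have "c < a n" for n using assms(2)[of n] by (meson not_le less_le_trans)
  then show ?thesis by simp
qed

lemma tight_if_second_moments_bounded:
  assumes Q: "\<And>n. Qs n \<in> P2" and B: "\<And>n. (\<integral>x. x\<^sup>2 \<partial>Qs n) \<le> B"
  shows "tight Qs"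
  unfolding tight_def
proof (intro conjI allI impI)
  show rd: "real_distribution (Qs n)" for n using Q by (rule P2_real_distribution)
  fix \<epsilon> :: real assume \<epsilon>: "0 < \<epsilon>"
  \<comment> \<open>Chebyshev bounds the mass outside by |B| / R^2; the added 1 makes this strictly
    smaller than \<epsilon> and R positive even when B = 0.\<close>
  define R where "R = sqrt ((\<bar>B\<bar> + 1) / \<epsilon>)"
  have R: "0 < R" "R\<^sup>2 = (\<bar>B\<bar> + 1) / \<epsilon>" using \<epsilon> by (simp_all add: R_def)
  have "1 - \<epsilon> < measure (Qs n) {- R<..R}" for n
  proof -
    interpret real_distribution "Qs n" by (rule rd)
    have "prob {x \<in> space (Qs n). R\<^sup>2 \<le> x\<^sup>2} \<le> (\<integral>x. x\<^sup>2 \<partial>Qs n) / R\<^sup>2"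
      using Q[of n] R(1) by (intro integral_Markov_inequality_measure[where A="space (Qs n)"]) (auto simp: P2_def)
    also have "\<dots> \<le> \<bar>B\<bar> / R\<^sup>2"
      using B[of n] by (intro divide_right_mono) auto
    also have "\<dots> = \<epsilon> * (\<bar>B\<bar> / (\<bar>B\<bar> + 1))" by (simp add: R(2))
    also have "\<dots> < \<epsilon> * 1"
      using \<epsilon> by (intro mult_strict_left_mono) (auto simp: divide_less_eq)
    finally have 1: "prob {x. R\<^sup>2 \<le> x\<^sup>2} < \<epsilon>" by simp
    have "1 - prob {- R<..R} = prob (UNIV - {- R<..R})"
      by (subst finite_measure_Diff) auto
    also have "\<dots> \<le> prob {x. R\<^sup>2 \<le> x\<^sup>2}"
    proof (intro finite_measure_mono subsetI)
      fix x assume "x \<in> UNIV - {- R<..R}"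
      then have "\<bar>R\<bar> \<le> \<bar>x\<bar>" using R(1) by auto
      then show "x \<in> {x. R\<^sup>2 \<le> x\<^sup>2}" by (simp only: abs_le_square_iff mem_Collect_eq)
    qed auto
    finally show ?thesis using 1 by simp
  qed
  then show "\<exists>a b. a < b \<and> (\<forall>n. 1 - \<epsilon> < measure (Qs n) {a<..b})"
    using R(1) by (intro exI[of _ "- R"] exI[of _ R]) auto
qed

theorem cost_minimizer_exists:
  assumes P: "P \<in> P2" and k: "0 < k"
  shows "\<exists>Q. is_arg_min (cost P k) (\<lambda>Q. Q \<in> P2) Q"
proof -
  have "\<exists>Q\<in>P2. cost P k Q < J_star P k + 1 / real (Suc n)" for n
    using P cInf_lessD[of "cost P k ` P2" "J_star P k + 1 / real (Suc n)"]
    by (auto simp: J_star_def)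
  then obtain Qs where Qs: "\<And>n. Qs n \<in> P2" "\<And>n. cost P k (Qs n) < J_star P k + 1 / real (Suc n)"
    by metis
  \<comment> \<open>Every member of the minimizing sequence costs at most
    \<open>J_star P k + 1\<close>. Dropping its mmse bounds the transport cost, hence the second
    moments, which gives tightness.\<close>
  define B where "B = (J_star P k + 1) / k\<^sup>2"
  have W: "W2_sq P (Qs n) \<le> B" for n
  proof -
    have "k\<^sup>2 * W2_sq P (Qs n) \<le> cost P k (Qs n)"
      using mmse_nonneg[OF Qs(1)] by (simp add: cost_def)
    also have "\<dots> \<le> J_star P k + 1"
      using Qs(2)[of n] by (rule order_trans[OF less_imp_le]) simp
    finally show ?thesis using k by (simp add: B_def pos_le_divide_eq mult.commute)
  qed
  have "(\<integral>x. x\<^sup>2 \<partial>Qs n) \<le> 2 * (\<integral>x. x\<^sup>2 \<partial>P) + 2 * B" for n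
    using second_moment_le_W2_sq[OF P Qs(1), of n] W[of n] by simp
  with Qs(1) have "tight Qs" by (rule tight_if_second_moments_bounded)
  then obtain r M where r: "strict_mono r" and M: "real_distribution M" and conv: "weak_conv_m (Qs \<circ> r) M"
    using tight_imp_convergent_subsubsequence[of Qs id] by (auto simp: strict_mono_id)
  have Qr: "(Qs \<circ> r) n \<in> P2" for n by (simp add: Qs(1))
  have rd: "real_distribution P" using P by (rule P2_real_distribution)
  have "cdf_cost P M \<le> liminf (\<lambda>n. cdf_cost P ((Qs \<circ> r) n))"
    using rd P2_real_distribution[OF Qr] M conv by (rule cdf_cost_lower_semicontinuous)
  \<comment> \<open>The limit \<open>M\<close> enters through \<open>cdf_cost\<close> until it is
    known to lie in \<open>P2\<close>.\<close>
  then have W_lim: "cdf_cost P M \<le> liminf (\<lambda>n. ennreal (W2_sq P ((Qs \<circ> r) n)))"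
    by (simp only: ennreal_W2_sq[OF P Qr])
  also have "\<dots> \<le> liminf (\<lambda>n. ennreal B)"
    using W by (intro Liminf_mono always_eventually) (auto intro: ennreal_leI)
  also have "\<dots> < \<infinity>" by (simp add: Liminf_const)
  finally have "cdf_cost P M < \<infinity>" .
  with P M have M2: "M \<in> P2" by (rule P2_if_cdf_cost_finite)
  have "cost P k M \<le> J_star P k"
  proof (rule ccontr)
    assume neg: "\<not> cost P k M \<le> J_star P k"
    \<comment> \<open>The excess \<delta> is shared out: the transport charge may drop by \<delta>/4
      (hence the division by 4 k^2), the mmse by \<delta>/4, and near-minimality adds less than
      \<delta>/2. The strict inequalities then contradict the definition of \<delta>.\<close>
    define \<delta> where "\<delta> = cost P k M - J_star P k"
    then have \<delta>: "0 < \<delta>" using neg by simp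
    have "eventually (\<lambda>n. W2_sq P M - \<delta> / (4 * k\<^sup>2) < W2_sq P ((Qs \<circ> r) n)) sequentially"
      using W_lim \<delta> k unfolding ennreal_W2_sq[OF P M2, symmetric]
      by (intro eventually_less_if_ennreal_le_liminf W2_sq_nonneg[OF P Qr]) auto
    moreover have "eventually (\<lambda>n. mmse M - \<delta> / 4 < mmse ((Qs \<circ> r) n)) sequentially"
      using mmse_lower_semicontinuous[OF Qr M2 conv] \<delta>
      by (intro eventually_less_if_ennreal_le_liminf mmse_nonneg[OF Qr]) auto
    moreover have "eventually (\<lambda>n. 1 / real (Suc n) < \<delta> / 2) sequentially"
      using \<delta> by real_asymp
    ultimately have "eventually (\<lambda>n::nat. False) sequentially"
    proof eventually_elim
      case (elim n)
      have "k\<^sup>2 * (W2_sq P M - \<delta> / (4 * k\<^sup>2)) \<le> k\<^sup>2 * W2_sq P ((Qs \<circ> r) n)"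
        using elim(1) by (intro mult_left_mono) auto
      moreover have "k\<^sup>2 * (W2_sq P M - \<delta> / (4 * k\<^sup>2)) = k\<^sup>2 * W2_sq P M - \<delta> / 4"
        using k by (simp add: right_diff_distrib)
      ultimately have "cost P k M - \<delta> / 2 < cost P k (Qs (r n))"
        using elim(2) by (simp add: cost_def)
      moreover have "1 / real (Suc (r n)) \<le> 1 / real (Suc n)"
        using seq_suble[OF r, of n] by (intro divide_left_mono) auto
      ultimately have "cost P k M - \<delta> / 2 < J_star P k + \<delta> / 2"
        using Qs(2)[of "r n"] elim(3) by simp
      then show False by (simp add: \<delta>_def field_simps)
    qed
    then show False by simp
  qed
  then have "is_arg_min (cost P k) (\<lambda>Q. Q \<in> P2) M"
    using M2 J_star_le_cost[OF P, of _ k] by (force simp: is_arg_min_def)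
  then show ?thesis ..
qed

lemma J_star_eq_cost:
  assumes P: "P \<in> P2" and Q: "is_arg_min (cost P k) (\<lambda>Q. Q \<in> P2) Q"
  shows "Q \<in> P2" "cost P k Q = J_star P k"
proof -
  show Q2: "Q \<in> P2" using Q by (simp add: is_arg_min_def)
  have "cost P k Q \<le> J_star P k"
    unfolding J_star_def using Q P by (intro cINF_greatest) (auto simp: is_arg_min_def not_less)
  then show "cost P k Q = J_star P k"
    using J_star_le_cost[OF P Q2] by (simp add: antisym)
qed

section \<open>Displacing the input of a fixed estimator\<close>

text \<open>From u^2 \<le> 2 w^2 + 2 follows -w^2/2 \<le> 1/2 - u^2/4, and the factor exp(1/2) is
  absorbed by the normalization sqrt(2 pi). One bound in u thus controls the kernel on the whole
  unit neighbourhood of u.\<close>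

lemma std_normal_density_le_exp:
  assumes "\<bar>u - w\<bar> \<le> 1"
  shows "\<phi> w \<le> exp (- u\<^sup>2 / 4)"
proof -
  have "(exp (1 / 2))\<^sup>2 = exp (1 :: real)"
    by (simp add: power2_eq_square flip: exp_add)
  also have "\<dots> \<le> 2 * pi" using exp_le pi_gt3 by simp
  finally have e: "exp (1 / 2) \<le> sqrt (2 * pi)" by (rule real_le_rsqrt)
  have "(u - w)\<^sup>2 \<le> 1" using assms by (simp add: abs_square_le_1)
  then have "u\<^sup>2 \<le> 2 * w\<^sup>2 + 2"
    using square_diff_le[of "w" "w - u"] by (simp add: power2_commute)
  then have "- w\<^sup>2 / 2 \<le> 1 / 2 + - u\<^sup>2 / 4" by simp
  then have "exp (- w\<^sup>2 / 2) \<le> exp (1 / 2) * exp (- u\<^sup>2 / 4)"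
    unfolding exp_add[symmetric] by (simp only: exp_le_cancel_iff)
  also have "\<dots> \<le> sqrt (2 * pi) * exp (- u\<^sup>2 / 4)"
    using e by (rule mult_right_mono) simp
  finally show ?thesis
    by (simp add: std_normal_density_def divide_le_eq mult.commute)
qed

text \<open>Two powers of 1 + |u| come from the squared estimation error and one from
  differentiating the kernel.\<close>

definition envelope :: "real \<Rightarrow> real" where
  "envelope u = (1 + \<bar>u\<bar>) ^ 3 * exp (- u\<^sup>2 / 4)"

text \<open>If |x - y| \<ge> 1, the error at y is discarded and the factor |x - y| pays for the
  whole error at x. If |x - y| < 1, the mean value inequality applies on the segment from x to y,
  all of whose points lie within 1 of x. In both cases the constant involves x and z alone.\<close>

lemma estimator_error_shift:
  assumes g: "\<bar>g\<bar> \<le> K * (1 + \<bar>z\<bar>)" and K: "0 \<le> K"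
  shows "(x - g)\<^sup>2 * \<phi> (z - x) \<le> (y - g)\<^sup>2 * \<phi> (z - y) +
    3 * (K + 1)\<^sup>2 * ((1 + \<bar>x\<bar>)\<^sup>2 * \<bar>x - y\<bar>) * envelope (z - x)"
proof -
  define u where "u = z - x"
  \<comment> \<open>A bound for the distance from the estimate g to any point within 1 of x.\<close>
  define R where "R = (K + 1) * (1 + \<bar>x\<bar>) * (1 + \<bar>u\<bar>)"
  have "1 * 1 * 1 \<le> R" unfolding R_def using K by (intro mult_mono) auto
  then have R1: "1 \<le> R" by simp
  have R: "\<bar>t - g\<bar> \<le> R" if "\<bar>t - x\<bar> \<le> 1" for t
  proof -
    have "\<bar>t - g\<bar> \<le> (1 + \<bar>x\<bar>) + K * (1 + \<bar>z\<bar>)"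
      using that g by (auto simp: abs_if split: if_splits)
    also have "\<dots> \<le> (1 + \<bar>x\<bar> + \<bar>u\<bar>) + K * (1 + \<bar>x\<bar> + \<bar>u\<bar>)"
    proof -
      have "\<bar>z\<bar> \<le> \<bar>x\<bar> + \<bar>u\<bar>"
        using abs_triangle_ineq[of x u] by (simp add: u_def)
      then have "K * (1 + \<bar>z\<bar>) \<le> K * (1 + \<bar>x\<bar> + \<bar>u\<bar>)"
        using K by (intro mult_left_mono) auto
      then show ?thesis by simp
    qed
    also have "\<dots> = (K + 1) * (1 + \<bar>x\<bar> + \<bar>u\<bar>)" by algebra
    also have "\<dots> \<le> (K + 1) * ((1 + \<bar>x\<bar>) * (1 + \<bar>u\<bar>))"
      using K by (intro mult_left_mono) (auto simp: algebra_simps)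
    finally show ?thesis by (simp add: R_def mult.assoc)
  qed
  have bound: "3 * R\<^sup>2 * (1 + \<bar>u\<bar>) * exp (- u\<^sup>2 / 4) = 3 * (K + 1)\<^sup>2 * (1 + \<bar>x\<bar>)\<^sup>2 * envelope u"
    unfolding R_def envelope_def by algebra
  have R2: "R\<^sup>2 \<le> 3 * R\<^sup>2 * (1 + \<bar>u\<bar>)"
    using mult_left_mono[of 1 "3 * (1 + \<bar>u\<bar>)" "R\<^sup>2"] by (simp add: algebra_simps)
  have "(x - g)\<^sup>2 * \<phi> (z - x) - (y - g)\<^sup>2 * \<phi> (z - y) \<le> \<bar>x - y\<bar> * (3 * R\<^sup>2 * (1 + \<bar>u\<bar>) * exp (- u\<^sup>2 / 4))"
  proof (cases "1 \<le> \<bar>x - y\<bar>")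
    case True
    have "(x - g)\<^sup>2 * \<phi> (z - x) \<le> R\<^sup>2 * exp (- u\<^sup>2 / 4)"
      using R[of x] R1 by (intro mult_mono std_normal_density_le_exp) (auto simp: u_def abs_le_square_iff[symmetric])
    also have "\<dots> \<le> 1 * (3 * R\<^sup>2 * (1 + \<bar>u\<bar>) * exp (- u\<^sup>2 / 4))"
      using mult_right_mono[OF R2, of "exp (- u\<^sup>2 / 4)"] by simp
    also have "\<dots> \<le> \<bar>x - y\<bar> * (3 * R\<^sup>2 * (1 + \<bar>u\<bar>) * exp (- u\<^sup>2 / 4))"
      using True by (intro mult_right_mono) auto
    finally show ?thesis by (simp add: add_increasing2 diff_le_eq)
  next
    case False
    define F where "F t = (t - g)\<^sup>2 * \<phi> (z - t)" for t
    define F' where "F' t = (2 * (t - g) + (t - g)\<^sup>2 * (z - t)) * \<phi> (z - t)" for t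
    have D: "(F has_real_derivative F' t) (at t)" for t
    proof -
      have d1: "((\<lambda>t. \<phi> (z - t)) has_real_derivative (z - t) * \<phi> (z - t)) (at t)"
        unfolding std_normal_density_def
        by (rule derivative_eq_intros refl | simp add: field_simps)+
      have d2: "((\<lambda>t. (t - g)\<^sup>2) has_real_derivative 2 * (t - g)) (at t)"
        by (rule derivative_eq_intros refl | simp)+
      show ?thesis
        unfolding F_def F'_def
        by (rule DERIV_cong[OF DERIV_mult[OF d2 d1]]) (simp add: algebra_simps)
    qed
    have F': "\<bar>F' t\<bar> \<le> 3 * R\<^sup>2 * (1 + \<bar>u\<bar>) * exp (- u\<^sup>2 / 4)" if t: "\<bar>t - x\<bar> \<le> 1" for t
    proof -
      have a: "\<bar>t - g\<bar> \<le> R" using t by (rule R)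
      have "\<bar>2 * (t - g) + (t - g)\<^sup>2 * (z - t)\<bar> \<le> 2 * \<bar>t - g\<bar> + \<bar>t - g\<bar>\<^sup>2 * \<bar>z - t\<bar>"
        by (rule order_trans[OF abs_triangle_ineq])
           (simp only: abs_mult abs_numeral power2_abs abs_power2 order_refl)
      \<comment> \<open>R \<ge> 1 turns the linear term into 2 R^2, and |z - t| \<le> 1 + |u|
        because t is within 1 of x.\<close>
      also have "\<dots> \<le> 2 * R\<^sup>2 * (1 + \<bar>u\<bar>) + R\<^sup>2 * (1 + \<bar>u\<bar>)"
      proof (intro add_mono)
        have "2 * \<bar>t - g\<bar> \<le> 2 * R" using a by simp
        also have "\<dots> \<le> 2 * (R * R)" using R1 by simp
        also have "\<dots> \<le> 2 * (R * R) * (1 + \<bar>u\<bar>)"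
          using R1 by (simp add: distrib_left)
        finally show "2 * \<bar>t - g\<bar> \<le> 2 * R\<^sup>2 * (1 + \<bar>u\<bar>)" by (simp add: power2_eq_square)
        show "\<bar>t - g\<bar>\<^sup>2 * \<bar>z - t\<bar> \<le> R\<^sup>2 * (1 + \<bar>u\<bar>)"
          using a t by (intro mult_mono power_mono) (auto simp: u_def)
      qed
      also have "\<dots> = 3 * R\<^sup>2 * (1 + \<bar>u\<bar>)" by algebra
      finally have "\<bar>2 * (t - g) + (t - g)\<^sup>2 * (z - t)\<bar> \<le> 3 * R\<^sup>2 * (1 + \<bar>u\<bar>)" .
      moreover have "\<phi> (z - t) \<le> exp (- u\<^sup>2 / 4)"
        using t by (intro std_normal_density_le_exp) (auto simp: u_def)
      ultimately show ?thesis
        unfolding F'_def abs_mult by (intro mult_mono) auto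
    qed
    have "norm (F x - F y) \<le> (3 * R\<^sup>2 * (1 + \<bar>u\<bar>) * exp (- u\<^sup>2 / 4)) * norm (x - y)"
    proof (rule field_differentiable_bound[of "closed_segment x y"])
      show "(F has_field_derivative F' t) (at t within closed_segment x y)" for t
        using D by (rule DERIV_subset) simp
      show "norm (F' t) \<le> 3 * R\<^sup>2 * (1 + \<bar>u\<bar>) * exp (- u\<^sup>2 / 4)" if "t \<in> closed_segment x y" for t
        using F'[of t] False that by (auto simp: closed_segment_eq_real_ivl split: if_splits)
    qed auto
    then show ?thesis by (simp add: F_def mult.commute)
  qed
  then show ?thesis
    unfolding bound by (simp add: u_def mult_ac)
qed

text \<open>exp(-u^2/4) is sqrt(4 pi) times the normal density of standard deviation sqrt 2, so
  expanding the cube leaves absolute Gaussian moments.\<close>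

lemma integrable_envelope: "integrable lborel envelope"
proof -
  have "integrable lborel (\<lambda>u. sqrt (4 * pi) * (normal_density 0 (sqrt 2) u * \<bar>u - 0\<bar> ^ 0 +
    3 * (normal_density 0 (sqrt 2) u * \<bar>u - 0\<bar> ^ 1) + 3 * (normal_density 0 (sqrt 2) u * \<bar>u - 0\<bar> ^ 2) +
    normal_density 0 (sqrt 2) u * \<bar>u - 0\<bar> ^ 3))"
    by (intro integrable_mult_right Bochner_Integration.integrable_add integrable_normal_moment_abs) auto
  also have "(\<lambda>u. sqrt (4 * pi) * (normal_density 0 (sqrt 2) u * \<bar>u - 0\<bar> ^ 0 +
    3 * (normal_density 0 (sqrt 2) u * \<bar>u - 0\<bar> ^ 1) + 3 * (normal_density 0 (sqrt 2) u * \<bar>u - 0\<bar> ^ 2) +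
    normal_density 0 (sqrt 2) u * \<bar>u - 0\<bar> ^ 3)) = envelope"
  proof
    fix u :: real
    have "sqrt (4 * pi) * normal_density 0 (sqrt 2) u = exp (- u\<^sup>2 / 4)"
      by (simp add: normal_density_def real_sqrt_mult)
    moreover have "(1 + \<bar>u\<bar>) ^ 3 = 1 + 3 * \<bar>u\<bar> + 3 * \<bar>u\<bar> ^ 2 + \<bar>u\<bar> ^ 3"
      by (simp add: power3_eq_cube power2_eq_square algebra_simps)
    ultimately show "sqrt (4 * pi) * (normal_density 0 (sqrt 2) u * \<bar>u - 0\<bar> ^ 0 +
      3 * (normal_density 0 (sqrt 2) u * \<bar>u - 0\<bar> ^ 1) + 3 * (normal_density 0 (sqrt 2) u * \<bar>u - 0\<bar> ^ 2) +
      normal_density 0 (sqrt 2) u * \<bar>u - 0\<bar> ^ 3) = envelope u"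
      unfolding envelope_def by (simp only: diff_0_right power_0 power_one_right mult_1_right) (simp add: algebra_simps)
  qed
  finally show ?thesis .
qed

text \<open>The two errors use the same estimator, the posterior mean of \<open>Q\<close>, so the inputs are
  compared along the quantile coupling. Only fourth moments of \<open>P\<close> enter, because
  \<open>estimator_error_shift\<close> does not involve the size of \<open>y\<close>.\<close>

lemma mmse_le_cost:
  assumes P: "P \<in> P2" and P4: "integrable P (\<lambda>x. (1 + \<bar>x\<bar>) ^ 4)" and Q: "Q \<in> P2" and k: "0 < k"
  defines "c \<equiv> 3 * (3 + (\<integral>y. \<bar>y\<bar> \<partial>Q))\<^sup>2 * (\<integral>u. envelope u \<partial>lborel)"
  shows "mmse P \<le> cost P k Q + c\<^sup>2 * (\<integral>x. (1 + \<bar>x\<bar>) ^ 4 \<partial>P) / (4 * k\<^sup>2)"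
proof -
  interpret P: real_distribution P using P by (rule P2_real_distribution)
  interpret Q: real_distribution Q using Q by (rule P2_real_distribution)
  interpret U: prob_space unit_lebesgue by (rule prob_space_unit_lebesgue)
  interpret LU: pair_sigma_finite lborel unit_lebesgue ..
  \<comment> \<open>Chosen so that the bound 2|z| + E|Y| on the posterior mean of \<open>Q\<close>
    is at most K (1 + |z|).\<close>
  define K where "K = 2 + (\<integral>y. \<bar>y\<bar> \<partial>Q)"
  define A where "A = (\<integral>u. envelope u \<partial>lborel)"
  define m where "m = (\<integral>x. (1 + \<bar>x\<bar>) ^ 4 \<partial>P)"
  define p where "p = quantile P"
  define q where "q = quantile Q"
  define g where "g = posterior_mean Q"
  have rdP: "real_distribution P" and rdQ: "real_distribution Q" by unfold_locales
  have [measurable]: "p \<in> borel_measurable unit_lebesgue" "q \<in> borel_measurable unit_lebesgue"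
    unfolding p_def q_def using measurable_quantile[OF rdP] measurable_quantile[OF rdQ] by simp_all
  have [measurable]: "g \<in> borel_measurable borel" unfolding g_def by measurable
  have [measurable]: "envelope \<in> borel_measurable borel" unfolding envelope_def by measurable
  have env0: "0 \<le> envelope u" for u by (simp add: envelope_def)
  have A: "(\<integral>\<^sup>+u. ennreal (envelope u) \<partial>lborel) = ennreal A" "0 \<le> A"
    using integrable_envelope env0 by (simp_all add: A_def nn_integral_eq_integral)
  have a0: "0 \<le> (\<integral>y. \<bar>y\<bar> \<partial>Q)" by simp
  then have K: "0 \<le> K" by (simp add: K_def)
  have g: "\<bar>g z\<bar> \<le> K * (1 + \<bar>z\<bar>)" for z
  proof -
    have "\<bar>g z\<bar> \<le> 2 * \<bar>z\<bar> + (\<integral>y. \<bar>y\<bar> \<partial>Q)"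
      unfolding g_def using P2_integrable_id[OF Q] by (rule Q.abs_posterior_mean_le)
    also have "\<dots> \<le> K * (1 + \<bar>z\<bar>)"
      using a0 mult_nonneg_nonneg[OF a0 abs_ge_zero[of z]] by (simp add: K_def algebra_simps)
    finally show ?thesis .
  qed
  have c: "c = 3 * (K + 1)\<^sup>2 * A" by (simp add: c_def K_def A_def add.commute)
  have "ennreal (mmse P) \<le> (\<integral>\<^sup>+z. \<integral>\<^sup>+x. ennreal ((x - g z)\<^sup>2 * \<phi> (z - x)) \<partial>P \<partial>lborel)"
    by (rule P.mmse_le_estimator[OF P])
  also have "\<dots> = (\<integral>\<^sup>+z. \<integral>\<^sup>+u. ennreal ((p u - g z)\<^sup>2 * \<phi> (z - p u)) \<partial>unit_lebesgue \<partial>lborel)"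
    unfolding p_def by (intro nn_integral_cong nn_integral_quantile[symmetric] rdP) measurable
  also have "\<dots> \<le> (\<integral>\<^sup>+z. \<integral>\<^sup>+u. ennreal ((q u - g z)\<^sup>2 * \<phi> (z - q u)) +
      ennreal (3 * (K + 1)\<^sup>2 * ((1 + \<bar>p u\<bar>)\<^sup>2 * \<bar>p u - q u\<bar>)) * ennreal (envelope (z - p u)) \<partial>unit_lebesgue \<partial>lborel)"
  proof (intro nn_integral_mono)
    have split: "ennreal (a + b * e) = ennreal a + ennreal b * ennreal e" if "0 \<le> a" "0 \<le> b" "0 \<le> e" for a b e :: real
      using that by (simp add: ennreal_mult)
    fix z u
    show "ennreal ((p u - g z)\<^sup>2 * \<phi> (z - p u)) \<le> ennreal ((q u - g z)\<^sup>2 * \<phi> (z - q u)) +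
      ennreal (3 * (K + 1)\<^sup>2 * ((1 + \<bar>p u\<bar>)\<^sup>2 * \<bar>p u - q u\<bar>)) * ennreal (envelope (z - p u))"
      using ennreal_leI[OF estimator_error_shift[OF g K, where z=z and x="p u" and y="q u"]]
      by (subst (asm) split) (simp_all add: env0)
  qed
  also have "\<dots> = (\<integral>\<^sup>+z. \<integral>\<^sup>+u. ennreal ((q u - g z)\<^sup>2 * \<phi> (z - q u)) \<partial>unit_lebesgue \<partial>lborel) +
      (\<integral>\<^sup>+z. \<integral>\<^sup>+u. ennreal (3 * (K + 1)\<^sup>2 * ((1 + \<bar>p u\<bar>)\<^sup>2 * \<bar>p u - q u\<bar>)) * ennreal (envelope (z - p u)) \<partial>unit_lebesgue \<partial>lborel)"
    by (subst nn_integral_add[symmetric]) (auto intro!: nn_integral_cong nn_integral_add)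
  also have "(\<integral>\<^sup>+z. \<integral>\<^sup>+u. ennreal ((q u - g z)\<^sup>2 * \<phi> (z - q u)) \<partial>unit_lebesgue \<partial>lborel) = ennreal (mmse Q)"
  proof -
    have "(\<integral>\<^sup>+z. \<integral>\<^sup>+u. ennreal ((q u - g z)\<^sup>2 * \<phi> (z - q u)) \<partial>unit_lebesgue \<partial>lborel) =
        (\<integral>\<^sup>+z. \<integral>\<^sup>+y. ennreal ((y - g z)\<^sup>2 * \<phi> (z - y)) \<partial>Q \<partial>lborel)"
      unfolding q_def by (intro nn_integral_cong nn_integral_quantile rdQ) measurable
    also have "\<dots> = ennreal (mmse Q)"
      unfolding Q.ennreal_mmse[OF Q] g_def
      by (intro nn_integral_cong nn_integral_eq_integral Q.integral_square_kernel(2)) simp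
    finally show ?thesis .
  qed
  also have "(\<integral>\<^sup>+z. \<integral>\<^sup>+u. ennreal (3 * (K + 1)\<^sup>2 * ((1 + \<bar>p u\<bar>)\<^sup>2 * \<bar>p u - q u\<bar>)) * ennreal (envelope (z - p u)) \<partial>unit_lebesgue \<partial>lborel)
      \<le> ennreal (k\<^sup>2 * W2_sq P Q + c\<^sup>2 * m / (4 * k\<^sup>2))"
  proof -
    have "(\<integral>\<^sup>+z. \<integral>\<^sup>+u. ennreal (3 * (K + 1)\<^sup>2 * ((1 + \<bar>p u\<bar>)\<^sup>2 * \<bar>p u - q u\<bar>)) * ennreal (envelope (z - p u)) \<partial>unit_lebesgue \<partial>lborel)
      = (\<integral>\<^sup>+u. \<integral>\<^sup>+z. ennreal (3 * (K + 1)\<^sup>2 * ((1 + \<bar>p u\<bar>)\<^sup>2 * \<bar>p u - q u\<bar>)) * ennreal (envelope (z - p u)) \<partial>lborel \<partial>unit_lebesgue)"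
      by (rule LU.Fubini'[symmetric]) measurable
    also have "\<dots> = (\<integral>\<^sup>+u. ennreal (c * ((1 + \<bar>p u\<bar>)\<^sup>2 * \<bar>p u - q u\<bar>)) \<partial>unit_lebesgue)"
    \<comment> \<open>By translation invariance the envelope integrates over z to \<open>A\<close>,
      whatever its centre p u.\<close>
    proof (rule nn_integral_cong)
      fix u
      have "(\<integral>\<^sup>+z. ennreal (envelope (z - p u)) \<partial>lborel) = ennreal A"
        using nn_integral_real_affine[of "\<lambda>z. ennreal (envelope (z - p u))" 1 "p u"] A by simp
      then have "(\<integral>\<^sup>+z. ennreal (3 * (K + 1)\<^sup>2 * ((1 + \<bar>p u\<bar>)\<^sup>2 * \<bar>p u - q u\<bar>)) * ennreal (envelope (z - p u)) \<partial>lborel)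
          = ennreal (3 * (K + 1)\<^sup>2 * ((1 + \<bar>p u\<bar>)\<^sup>2 * \<bar>p u - q u\<bar>)) * ennreal A"
        by (subst nn_integral_cmult) auto
      also have "\<dots> = ennreal (c * ((1 + \<bar>p u\<bar>)\<^sup>2 * \<bar>p u - q u\<bar>))"
        using A(2) by (subst ennreal_mult[symmetric]) (auto simp: c mult_ac)
      finally show "(\<integral>\<^sup>+z. ennreal (3 * (K + 1)\<^sup>2 * ((1 + \<bar>p u\<bar>)\<^sup>2 * \<bar>p u - q u\<bar>)) * ennreal (envelope (z - p u)) \<partial>lborel)
          = ennreal (c * ((1 + \<bar>p u\<bar>)\<^sup>2 * \<bar>p u - q u\<bar>))" .
    qed
    also have "\<dots> \<le> (\<integral>\<^sup>+u. ennreal (k\<^sup>2 * (p u - q u)\<^sup>2 + c\<^sup>2 / (4 * k\<^sup>2) * (1 + \<bar>p u\<bar>) ^ 4) \<partial>unit_lebesgue)"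
    proof (intro nn_integral_mono ennreal_leI)
      fix u
      define a where "a = (1 + \<bar>p u\<bar>)\<^sup>2"
      define d where "d = \<bar>p u - q u\<bar>"
      \<comment> \<open>Young's inequality, weighted so that the distance term becomes exactly the
        transport charge k^2 d^2.\<close>
      have "0 \<le> (k * d - c / (2 * k) * a)\<^sup>2" by simp
      also have "\<dots> = k\<^sup>2 * d\<^sup>2 + c\<^sup>2 / (4 * k\<^sup>2) * a\<^sup>2 - c * (a * d)"
        using k by (simp add: power2_diff power_mult_distrib power_divide)
      finally show "c * ((1 + \<bar>p u\<bar>)\<^sup>2 * \<bar>p u - q u\<bar>) \<le> k\<^sup>2 * (p u - q u)\<^sup>2 + c\<^sup>2 / (4 * k\<^sup>2) * (1 + \<bar>p u\<bar>) ^ 4"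
        by (simp add: a_def d_def flip: power_mult)
    qed
    also have "\<dots> = ennreal (k\<^sup>2 * W2_sq P Q + c\<^sup>2 * m / (4 * k\<^sup>2))"
    proof -
      have i1: "integrable unit_lebesgue (\<lambda>u. (p u - q u)\<^sup>2)"
        unfolding p_def q_def
        by (intro integrable_square_diff integrable_quantile_P2 P Q measurable_quantile rdP rdQ)
      have "integrable (distr unit_lebesgue borel p) (\<lambda>x. (1 + \<bar>x\<bar>) ^ 4)"
        using P4 by (simp add: p_def distr_quantile[OF rdP])
      then have i2: "integrable unit_lebesgue (\<lambda>u. (1 + \<bar>p u\<bar>) ^ 4)"
        by (rule integrable_distr[rotated]) measurable
      have "(\<integral>x. (1 + \<bar>x\<bar>) ^ 4 \<partial>distr unit_lebesgue borel p) = (\<integral>u. (1 + \<bar>p u\<bar>) ^ 4 \<partial>unit_lebesgue)"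
        by (rule integral_distr) auto
      then have m: "(\<integral>u. (1 + \<bar>p u\<bar>) ^ 4 \<partial>unit_lebesgue) = m"
        by (simp add: p_def distr_quantile[OF rdP] m_def)
      have "(\<integral>\<^sup>+u. ennreal (k\<^sup>2 * (p u - q u)\<^sup>2 + c\<^sup>2 / (4 * k\<^sup>2) * (1 + \<bar>p u\<bar>) ^ 4) \<partial>unit_lebesgue) =
          ennreal (\<integral>u. k\<^sup>2 * (p u - q u)\<^sup>2 + c\<^sup>2 / (4 * k\<^sup>2) * (1 + \<bar>p u\<bar>) ^ 4 \<partial>unit_lebesgue)"
        using i1 i2 by (intro nn_integral_eq_integral) auto
      also have "(\<integral>u. k\<^sup>2 * (p u - q u)\<^sup>2 + c\<^sup>2 / (4 * k\<^sup>2) * (1 + \<bar>p u\<bar>) ^ 4 \<partial>unit_lebesgue) =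
          k\<^sup>2 * W2_sq P Q + c\<^sup>2 / (4 * k\<^sup>2) * m"
        using i1 i2 by (simp add: m[unfolded p_def] W2_sq_eq_quantile[OF P Q] p_def q_def)
      finally show ?thesis by simp
    qed
    finally show ?thesis .
  qed
  finally have "ennreal (mmse P) \<le> ennreal (mmse Q) + ennreal (k\<^sup>2 * W2_sq P Q + c\<^sup>2 * m / (4 * k\<^sup>2))"
    by simp
  moreover have "0 \<le> m" by (simp add: m_def)
  ultimately show ?thesis
    using mmse_nonneg[OF Q] W2_sq_nonneg[OF P Q]
    by (simp add: m_def cost_def flip: ennreal_plus)
qed

subsection \<open>Gaussian and two-level laws\<close>

lemma gaussian_cost:
  assumes "0 < \<sigma>" "0 < \<tau>"
  shows "cost (gaussian \<sigma>) k (gaussian \<tau>) = k\<^sup>2 * (\<sigma> - \<tau>)\<^sup>2 + \<tau>\<^sup>2 / (1 + \<tau>\<^sup>2)"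
  by (simp add: cost_def W2_sq_gaussian mmse_gaussian assms)

lemma one_plus_square_pos [simp]: "0 < 1 + (t::real)\<^sup>2"
  by (simp add: add_pos_nonneg)

lemma one_plus_square_nonzero [simp]: "1 + (t::real)\<^sup>2 \<noteq> 0"
  by (metis one_plus_square_pos less_irrefl)

text \<open>The equation says that k^2 (\<sigma> - \<tau>)^2 + \<tau>^2 / (1 + \<tau>^2), the cost
  within the Gaussian class, has zero derivative in \<tau>. Half of that derivative is negative at 0
  and positive at \<sigma>.\<close>

lemma stationary_point_exists:
  fixes \<sigma> k :: real
  assumes "0 < \<sigma>" "0 < k"
  shows "\<exists>\<tau>. 0 < \<tau> \<and> \<tau> < \<sigma> \<and> k\<^sup>2 * (\<sigma> - \<tau>) = \<tau> / (1 + \<tau>\<^sup>2)\<^sup>2"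
proof -
  define f where "f t = t / (1 + t\<^sup>2)\<^sup>2 - k\<^sup>2 * (\<sigma> - t)" for t
  have "continuous_on {0..\<sigma>} f"
    unfolding f_def by (intro continuous_intros) simp
  moreover have f0: "f 0 < 0" using assms by (simp add: f_def)
  moreover have f\<sigma>: "0 < f \<sigma>" using assms by (simp add: f_def)
  ultimately obtain \<tau> where \<tau>: "0 \<le> \<tau>" "\<tau> \<le> \<sigma>" "f \<tau> = 0"
    using IVT'[of f 0 0 \<sigma>] assms by auto
  have "\<tau> \<noteq> 0" "\<tau> \<noteq> \<sigma>" using \<tau>(3) f0 f\<sigma> by auto
  with \<tau> show ?thesis by (intro exI[of _ \<tau>]) (auto simp: f_def)
qed

text \<open>With \<open>\<tau>\<close> stationary, the increment of the cost factors as \<open>(t - \<tau>)\<^sup>2\<close> times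
  \<open>k\<^sup>2 - r\<close>, and \<open>r \<le> 1/4\<close> is a positive semidefinite quadratic in \<open>t\<close>; equality holds at
  \<open>t = \<tau> = 1\<close>, whence the threshold \<open>k\<^sup>2 > 1/4\<close>.\<close>

lemma gaussian_cost_strict:
  fixes \<sigma> \<tau> t k :: real
  assumes stat: "k\<^sup>2 * (\<sigma> - \<tau>) = \<tau> / (1 + \<tau>\<^sup>2)\<^sup>2" and k: "1 / 4 < k\<^sup>2" and ne: "t \<noteq> \<tau>"
  shows "k\<^sup>2 * (\<sigma> - \<tau>)\<^sup>2 + \<tau>\<^sup>2 / (1 + \<tau>\<^sup>2) < k\<^sup>2 * (\<sigma> - t)\<^sup>2 + t\<^sup>2 / (1 + t\<^sup>2)"
proof -
  define a where "a = 1 + \<tau>\<^sup>2"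
  define b where "b = 1 + t\<^sup>2"
  have pos: "0 < a" "0 < b" by (simp_all add: a_def b_def)
  have "16 * \<tau>\<^sup>2 \<le> 4 * a\<^sup>2"
  proof -
    have "0 \<le> 4 * (1 - \<tau>\<^sup>2)\<^sup>2" by simp
    also have "\<dots> = 4 * a\<^sup>2 - 16 * \<tau>\<^sup>2" unfolding a_def by algebra
    finally show ?thesis by simp
  qed
  also have "4 * a\<^sup>2 \<le> a\<^sup>2 * ((\<tau>\<^sup>2 - 1)\<^sup>2 + 4)"
    by (simp add: algebra_simps)
  \<comment> \<open>The square is completed in t; the part free of t is nonnegative by 16 \<tau>^2
    \<le> 4 a^2. Cancelling a^2 gives r \<le> 1/4.\<close>
  finally have "0 \<le> (a\<^sup>2 * t - 4 * \<tau>)\<^sup>2 + (a\<^sup>2 * ((\<tau>\<^sup>2 - 1)\<^sup>2 + 4) - 16 * \<tau>\<^sup>2)"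
    by (intro add_nonneg_nonneg) auto
  also have "\<dots> = a\<^sup>2 * (b * a\<^sup>2 - 4 * (\<tau>\<^sup>2 + 2 * t * \<tau> - 1))"
    unfolding a_def b_def by algebra
  finally have "4 * (\<tau>\<^sup>2 + 2 * t * \<tau> - 1) \<le> b * a\<^sup>2"
    using pos by (simp add: zero_le_mult_iff)
  then have "(\<tau>\<^sup>2 + 2 * t * \<tau> - 1) / (b * a\<^sup>2) \<le> 1 / 4"
    using pos by (simp add: divide_le_eq)
  from le_less_trans[OF this k] have "0 < k\<^sup>2 - (\<tau>\<^sup>2 + 2 * t * \<tau> - 1) / (b * a\<^sup>2)"
    by (simp only: diff_gt_0_iff_gt)
  then have "0 < (t - \<tau>)\<^sup>2 * (k\<^sup>2 - (\<tau>\<^sup>2 + 2 * t * \<tau> - 1) / (b * a\<^sup>2))"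
    using ne by simp
  also have "\<dots> = k\<^sup>2 * (t - \<tau>)\<^sup>2 - (t - \<tau>)\<^sup>2 * (\<tau>\<^sup>2 + 2 * t * \<tau> - 1) / (b * a\<^sup>2)"
    by (simp add: right_diff_distrib mult.commute)
  \<comment> \<open>Up to sign, this is the remainder of t^2 / (1 + t^2) after its linear
    approximation at \<tau>. Stationarity then identifies the slope with k^2 (\<sigma> -
    \<tau>).\<close>
  also have "(t - \<tau>)\<^sup>2 * (\<tau>\<^sup>2 + 2 * t * \<tau> - 1) / (b * a\<^sup>2) =
      2 * (\<tau> / a\<^sup>2) * (t - \<tau>) - (t\<^sup>2 / b - \<tau>\<^sup>2 / a)"
  proof -
    have "(t - \<tau>)\<^sup>2 * (\<tau>\<^sup>2 + 2 * t * \<tau> - 1) = 2 * \<tau> * (t - \<tau>) * b - (t\<^sup>2 * a - \<tau>\<^sup>2 * b) * a"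
      unfolding a_def b_def by algebra
    then have "(t - \<tau>)\<^sup>2 * (\<tau>\<^sup>2 + 2 * t * \<tau> - 1) / (b * a\<^sup>2) =
        (2 * \<tau> * (t - \<tau>) * b - (t\<^sup>2 * a - \<tau>\<^sup>2 * b) * a) / (b * a\<^sup>2)" by simp
    also have "\<dots> = 2 * (\<tau> / a\<^sup>2) * (t - \<tau>) - (t\<^sup>2 / b - \<tau>\<^sup>2 / a)"
      using pos by (simp add: divide_simps) (simp add: power2_eq_square algebra_simps)
    finally show ?thesis .
  qed
  also have "\<tau> / a\<^sup>2 = k\<^sup>2 * (\<sigma> - \<tau>)" using stat by (simp add: a_def)
  also have "k\<^sup>2 * (t - \<tau>)\<^sup>2 - (2 * (k\<^sup>2 * (\<sigma> - \<tau>)) * (t - \<tau>) - (t\<^sup>2 / b - \<tau>\<^sup>2 / a)) =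
      (k\<^sup>2 * (\<sigma> - t)\<^sup>2 + t\<^sup>2 / b) - (k\<^sup>2 * (\<sigma> - \<tau>)\<^sup>2 + \<tau>\<^sup>2 / a)"
    by algebra
  finally show ?thesis by (simp add: a_def b_def)
qed

lemma stationary_point_bound:
  fixes \<sigma> \<tau> k :: real
  assumes stat: "k\<^sup>2 * (\<sigma> - \<tau>) = \<tau> / (1 + \<tau>\<^sup>2)\<^sup>2" and k: "0 < k"
  shows "\<sigma> - \<tau> \<le> 1 / k\<^sup>2"
proof -
  have "0 \<le> (2 * \<tau> - 1)\<^sup>2" by simp
  then have "\<tau> \<le> 1 + \<tau>\<^sup>2" by (simp add: power2_eq_square algebra_simps)
  also have "\<dots> \<le> (1 + \<tau>\<^sup>2)\<^sup>2" by (rule self_le_power) auto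
  finally have "\<tau> / (1 + \<tau>\<^sup>2)\<^sup>2 \<le> 1" by (simp add: divide_le_eq)
  with stat k show ?thesis by (simp add: pos_le_divide_eq mult.commute)
qed

text \<open>A stationary parameter is chosen for every k > 0 and lies within 1/k^2 of \<sigma>. For
  k^2 > 1/4 it is strictly better than every other parameter, which yields existence and uniqueness
  together.\<close>

lemma gaussian_class_minimizers:
  assumes \<sigma>: "0 < \<sigma>"
  obtains \<tau> :: "real \<Rightarrow> real" where
    "\<And>k. 0 < k \<Longrightarrow> 0 < \<tau> k"
    "\<And>k Q. 0 < k \<Longrightarrow> 1/4 < k\<^sup>2 \<Longrightarrow>
      is_arg_min (cost (gaussian \<sigma>) k) (\<lambda>Q. Q \<in> gaussian ` {0<..}) Q \<longleftrightarrow> Q = gaussian (\<tau> k)"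
    "\<And>k. 0 < k \<Longrightarrow> \<bar>\<sigma> - \<tau> k\<bar> \<le> 1 / k\<^sup>2"
proof -
  have "\<exists>\<tau>. \<forall>k>0. 0 < \<tau> k \<and> \<tau> k < \<sigma> \<and> k\<^sup>2 * (\<sigma> - \<tau> k) = \<tau> k / (1 + (\<tau> k)\<^sup>2)\<^sup>2"
    using stationary_point_exists[OF \<sigma>] by metis
  then obtain \<tau> where \<tau>: "\<And>k. 0 < k \<Longrightarrow> 0 < \<tau> k" "\<And>k. 0 < k \<Longrightarrow> \<tau> k < \<sigma>"
      "\<And>k. 0 < k \<Longrightarrow> k\<^sup>2 * (\<sigma> - \<tau> k) = \<tau> k / (1 + (\<tau> k)\<^sup>2)\<^sup>2"
    by blast
  have strict: "cost (gaussian \<sigma>) k (gaussian (\<tau> k)) < cost (gaussian \<sigma>) k (gaussian t)"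
    if "0 < k" "1/4 < k\<^sup>2" "0 < t" "t \<noteq> \<tau> k" for k t
    unfolding gaussian_cost[OF \<sigma> \<tau>(1)[OF that(1)]] gaussian_cost[OF \<sigma> that(3)]
    by (rule gaussian_cost_strict[OF \<tau>(3)[OF that(1)] that(2,4)])
  show ?thesis
  proof (rule that)
    show "0 < \<tau> k" if "0 < k" for k using \<tau>(1) that .
    show "\<bar>\<sigma> - \<tau> k\<bar> \<le> 1 / k\<^sup>2" if "0 < k" for k
      using stationary_point_bound[OF \<tau>(3)[OF that] that] \<tau>(2)[OF that] by simp
    fix k :: real and Q assume k: "0 < k" "1/4 < k\<^sup>2"
    show "is_arg_min (cost (gaussian \<sigma>) k) (\<lambda>Q. Q \<in> gaussian ` {0<..}) Q \<longleftrightarrow> Q = gaussian (\<tau> k)"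
    proof
      assume Q: "is_arg_min (cost (gaussian \<sigma>) k) (\<lambda>Q. Q \<in> gaussian ` {0<..}) Q"
      then obtain t where t: "0 < t" "Q = gaussian t" by (auto simp: is_arg_min_def)
      have "\<not> cost (gaussian \<sigma>) k (gaussian (\<tau> k)) < cost (gaussian \<sigma>) k Q"
        using Q \<tau>(1)[OF k(1)] by (auto simp: is_arg_min_def)
      then show "Q = gaussian (\<tau> k)" using strict[OF k t(1)] t(2) by blast
    next
      assume Q: "Q = gaussian (\<tau> k)"
      have "\<not> cost (gaussian \<sigma>) k (gaussian t) < cost (gaussian \<sigma>) k (gaussian (\<tau> k))" if "0 < t" for t
        using strict[OF k that] by (cases "t = \<tau> k") auto
      then show "is_arg_min (cost (gaussian \<sigma>) k) (\<lambda>Q. Q \<in> gaussian ` {0<..}) Q"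
        using \<tau>(1)[OF k(1)] by (auto simp: Q is_arg_min_def)
    qed
  qed
qed

section \<open>Size of the gap for large k\<close>

lemma J_star_gaussian_le_mmse:
  assumes \<sigma>: "0 < \<sigma>"
  shows "J_star (gaussian \<sigma>) k \<le> mmse (gaussian \<sigma>)"
  using J_star_le_cost[OF gaussian_in_P2[OF \<sigma>] gaussian_in_P2[OF \<sigma>], of k]
  by (simp add: gaussian_cost[OF \<sigma> \<sigma>] mmse_gaussian[OF \<sigma>])

text \<open>The competitor Q = P costs only its mmse, so the transport charge of a minimizer cannot
  exceed that amount.\<close>

lemma W2_sq_minimizer_le:
  assumes \<sigma>: "0 < \<sigma>" and k: "0 < k" and Q: "is_arg_min (cost (gaussian \<sigma>) k) (\<lambda>Q. Q \<in> P2) Q"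
  shows "W2_sq (gaussian \<sigma>) Q \<le> mmse (gaussian \<sigma>) / k\<^sup>2"
proof -
  note P = gaussian_in_P2[OF \<sigma>]
  note Q' = J_star_eq_cost[OF P Q]
  have "k\<^sup>2 * W2_sq (gaussian \<sigma>) Q \<le> cost (gaussian \<sigma>) k Q"
    using mmse_nonneg[OF Q'(1)] by (simp add: cost_def)
  also have "\<dots> \<le> mmse (gaussian \<sigma>)"
    using Q'(2) J_star_gaussian_le_mmse[OF \<sigma>] by simp
  finally show ?thesis using k by (simp add: pos_le_divide_eq mult.commute)
qed

text \<open>The constant in \<open>mmse_le_cost\<close> depends on the minimizer through its mean
  absolute value. For k \<ge> 1 its transport distance squared is at most mmse P, which bounds the
  second moment; with |y| \<le> 1 + y^2 this gives the bound \<open>B\<close>, uniform in k.\<close>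

lemma mmse_minus_J_star_upper:
  assumes \<sigma>: "0 < \<sigma>"
  obtains C where "\<And>k. 1 \<le> k \<Longrightarrow> mmse (gaussian \<sigma>) - J_star (gaussian \<sigma>) k \<le> C / k\<^sup>2"
proof -
  let ?P = "gaussian \<sigma>"
  note P = gaussian_in_P2[OF \<sigma>]
  interpret P: real_distribution ?P using \<sigma> by (rule real_distribution_gaussian)
  define m where "m = (\<integral>x. (1 + \<bar>x\<bar>) ^ 4 \<partial>?P)"
  define A where "A = (\<integral>u. envelope u \<partial>lborel)"
  define B where "B = 1 + 2 * \<sigma>\<^sup>2 + 2 * mmse ?P"
  have P4: "integrable ?P (\<lambda>x. (1 + \<bar>x\<bar>) ^ 4)"
  proof (rule Bochner_Integration.integrable_bound)
    show "integrable ?P (\<lambda>x. 8 * (1 + x ^ 4))"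
      using integrable_gaussian_power[OF \<sigma>, of 4] by simp
    have "(1 + \<bar>x\<bar>) ^ 4 \<le> 8 * (1 + x ^ 4)" for x :: real
    proof -
      have "(1 + \<bar>x\<bar>)\<^sup>2 \<le> 2 * (1 + x\<^sup>2)"
        using square_diff_le[of 1 "- \<bar>x\<bar>"] by simp
      then have "((1 + \<bar>x\<bar>)\<^sup>2)\<^sup>2 \<le> (2 * (1 + x\<^sup>2))\<^sup>2"
        by (rule power_mono) simp
      also have "\<dots> = 4 * (1 + x\<^sup>2)\<^sup>2" by algebra
      also have "\<dots> \<le> 4 * (2 * (1 + (x\<^sup>2)\<^sup>2))"
        using square_diff_le[of 1 "- x\<^sup>2"] by simp
      finally show ?thesis by (simp flip: power_mult)
    qed
    then show "AE x in ?P. norm ((1 + \<bar>x\<bar>) ^ 4) \<le> norm (8 * (1 + x ^ 4))"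
      by (intro AE_I2) (simp add: order_trans[OF _ abs_ge_self])
  qed simp
  have A0: "0 \<le> A" by (simp add: A_def envelope_def)
  have m0: "0 \<le> m" by (simp add: m_def)
  have "mmse ?P - J_star ?P k \<le> (3 * (3 + B)\<^sup>2 * A)\<^sup>2 * m / 4 / k\<^sup>2" if k: "1 \<le> k" for k
  proof -
    have k0: "0 < k" using k by simp
    obtain Q where Q: "is_arg_min (cost ?P k) (\<lambda>Q. Q \<in> P2) Q"
      using cost_minimizer_exists[OF P k0] by blast
    note Q' = J_star_eq_cost[OF P Q]
    interpret Q: real_distribution Q using Q'(1) by (rule P2_real_distribution)
    have iQ: "integrable Q (\<lambda>y. y\<^sup>2)" using Q'(1) by (simp add: P2_def)
    have "W2_sq ?P Q \<le> mmse ?P / k\<^sup>2" by (rule W2_sq_minimizer_le[OF \<sigma> k0 Q])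
    also have "\<dots> \<le> mmse ?P / 1"
      using k mmse_nonneg[OF P] by (intro divide_left_mono) auto
    finally have W: "W2_sq ?P Q \<le> mmse ?P" by simp
    have "\<bar>y\<bar> \<le> 1 + y\<^sup>2" for y :: real
    proof -
      have "0 \<le> (2 * \<bar>y\<bar> - 1)\<^sup>2" by simp
      then show ?thesis by (simp add: power2_eq_square algebra_simps)
    qed
    then have "(\<integral>y. \<bar>y\<bar> \<partial>Q) \<le> (\<integral>y. 1 + y\<^sup>2 \<partial>Q)"
      using P2_integrable_id[OF Q'(1)] iQ by (intro integral_mono) auto
    also have "\<dots> = 1 + (\<integral>y. y\<^sup>2 \<partial>Q)" using iQ by simp
    also have "\<dots> \<le> B"
      using second_moment_le_W2_sq[OF P Q'(1)] W by (simp add: B_def integral_gaussian_square[OF \<sigma>])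
    finally have "3 + (\<integral>y. \<bar>y\<bar> \<partial>Q) \<le> 3 + B" by simp
    moreover have "0 \<le> (\<integral>y. \<bar>y\<bar> \<partial>Q)" by simp
    ultimately have c: "(3 * (3 + (\<integral>y. \<bar>y\<bar> \<partial>Q))\<^sup>2 * A)\<^sup>2 \<le> (3 * (3 + B)\<^sup>2 * A)\<^sup>2"
      using A0 by (intro power_mono mult_right_mono mult_left_mono) auto
    have "mmse ?P - J_star ?P k \<le> (3 * (3 + (\<integral>y. \<bar>y\<bar> \<partial>Q))\<^sup>2 * A)\<^sup>2 * m / (4 * k\<^sup>2)"
      using mmse_le_cost[OF P P4 Q'(1) k0] by (simp add: Q'(2) A_def m_def)
    also have "\<dots> \<le> (3 * (3 + B)\<^sup>2 * A)\<^sup>2 * m / (4 * k\<^sup>2)"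
      using c m0 by (intro divide_right_mono mult_right_mono) auto
    finally show ?thesis by simp
  qed
  then show ?thesis by (rule that)
qed

text \<open>Shrinking \<sigma> by \<delta> lowers the mmse by \<delta> (\<sigma> + \<tau>) / ((1 +
  \<sigma>^2)(1 + \<tau>^2)), which is at least a \<delta>, where a is half the derivative of the
  mmse at \<sigma>. The price is k^2 \<delta>^2, and \<delta> = a / (2 k^2) maximizes the net gain,
  to a^2 / (4 k^2). The lower bound imposed on k keeps \<delta> < \<sigma>.\<close>

lemma mmse_minus_J_star_lower:
  assumes \<sigma>: "0 < \<sigma>"
  obtains a k0 where "0 < a" "\<And>k. k0 \<le> k \<Longrightarrow> 0 < k \<Longrightarrow> a / k\<^sup>2 \<le> mmse (gaussian \<sigma>) - J_star (gaussian \<sigma>) k"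
proof -
  define a where "a = \<sigma> / (1 + \<sigma>\<^sup>2)\<^sup>2"
  have a: "0 < a" using \<sigma> unfolding a_def by (intro divide_pos_pos zero_less_power one_plus_square_pos)
  have "a\<^sup>2 / 4 / k\<^sup>2 \<le> mmse (gaussian \<sigma>) - J_star (gaussian \<sigma>) k"
    if k: "max 1 (a / \<sigma>) \<le> k" for k
  proof -
    define \<delta> where "\<delta> = a / (2 * k\<^sup>2)"
    define \<tau> where "\<tau> = \<sigma> - \<delta>"
    have k1: "1 \<le> k" "a / \<sigma> \<le> k" using k by auto
    have \<delta>: "0 < \<delta>" using a k1 by (simp add: \<delta>_def)
    have "a \<le> k * \<sigma>" using k1(2) \<sigma> by (simp add: pos_divide_le_eq)
    also have "\<dots> \<le> k\<^sup>2 * \<sigma>"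
      using k1(1) \<sigma> by (simp add: power2_eq_square)
    also have "\<dots> < 2 * k\<^sup>2 * \<sigma>" using k1(1) \<sigma> by simp
    finally have "\<delta> < \<sigma>"
      using k1(1) by (simp add: \<delta>_def pos_divide_less_eq mult_ac)
    then have \<tau>: "0 < \<tau>" "\<tau> \<le> \<sigma>" using \<delta> by (simp_all add: \<tau>_def)
    have "\<delta> * a = \<delta> * \<sigma> / ((1 + \<sigma>\<^sup>2) * (1 + \<sigma>\<^sup>2))"
      by (simp add: a_def power2_eq_square)
    also have "\<dots> \<le> \<delta> * (\<sigma> + \<tau>) / ((1 + \<sigma>\<^sup>2) * (1 + \<tau>\<^sup>2))"
      using \<delta> \<tau> \<sigma> by (intro frac_le mult_left_mono mult_nonneg_nonneg) (auto intro!: mult_pos_pos)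
    also have "\<dots> = \<sigma>\<^sup>2 / (1 + \<sigma>\<^sup>2) - \<tau>\<^sup>2 / (1 + \<tau>\<^sup>2)"
    proof -
      have "\<delta> * (\<sigma> + \<tau>) = \<sigma>\<^sup>2 * (1 + \<tau>\<^sup>2) - \<tau>\<^sup>2 * (1 + \<sigma>\<^sup>2)"
        unfolding \<tau>_def by algebra
      then show ?thesis by (simp add: diff_frac_eq)
    qed
    also have "\<dots> = mmse (gaussian \<sigma>) - (cost (gaussian \<sigma>) k (gaussian \<tau>) - k\<^sup>2 * \<delta>\<^sup>2)"
      unfolding gaussian_cost[OF \<sigma> \<tau>(1)] mmse_gaussian[OF \<sigma>] by (simp add: \<tau>_def)
    also have "\<dots> \<le> mmse (gaussian \<sigma>) - J_star (gaussian \<sigma>) k + k\<^sup>2 * \<delta>\<^sup>2"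
      using J_star_le_cost[OF gaussian_in_P2[OF \<sigma>] gaussian_in_P2[OF \<tau>(1)], of k] by simp
    finally have "\<delta> * a - k\<^sup>2 * \<delta>\<^sup>2 \<le> mmse (gaussian \<sigma>) - J_star (gaussian \<sigma>) k" by simp
    also have "\<delta> * a - k\<^sup>2 * \<delta>\<^sup>2 = a\<^sup>2 / 4 / k\<^sup>2"
      using k1(1) by (simp add: \<delta>_def power2_eq_square field_simps)
    finally show ?thesis .
  qed
  moreover have "0 < a\<^sup>2 / 4" using a by simp
  ultimately show ?thesis
    using that[of "a\<^sup>2 / 4" "max 1 (a / \<sigma>)"] by blast
qed

section \<open>The two-level law\<close>

lemma nn_integral_two_level:
  assumes "0 < M" and [measurable]: "f \<in> borel_measurable borel"
  shows "(\<integral>\<^sup>+x. f x \<partial>two_level M) = (f (- M) + f M) / 2"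
proof -
  have "(\<integral>\<^sup>+x. f x \<partial>two_level M) = (\<integral>\<^sup>+x. f x \<partial>measure_pmf (pmf_of_set {- M, M}))"
    unfolding two_level_def by (subst nn_integral_distr) auto
  also have "\<dots> = (f (- M) + f M) / 2"
    using assms(1) by (subst nn_integral_pmf_of_set) auto
  finally show ?thesis .
qed

lemma two_level_in_P2:
  assumes "0 < M"
  shows "two_level M \<in> P2" "(\<integral>x. x\<^sup>2 \<partial>two_level M) = M\<^sup>2"
proof -
  interpret real_distribution "two_level M"
    unfolding two_level_def by (rule prob_space.real_distribution_distr[OF prob_space_measure_pmf]) simp
  have "(\<integral>\<^sup>+x. ennreal (x\<^sup>2) \<partial>two_level M) = (ennreal (M\<^sup>2) + ennreal (M\<^sup>2)) / 2"
    using assms by (subst nn_integral_two_level) auto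
  also have "\<dots> = ennreal (M\<^sup>2)"
    by (simp add: divide_ennreal flip: ennreal_plus ennreal_numeral)
  finally have *: "(\<integral>\<^sup>+x. ennreal (x\<^sup>2) \<partial>two_level M) = ennreal (M\<^sup>2)" .
  then have "integrable (two_level M) (\<lambda>x. x\<^sup>2)"
    by (intro integrableI_nonneg) auto
  then show "two_level M \<in> P2"
    using real_distribution_axioms by (simp add: P2_def)
  show "(\<integral>x. x\<^sup>2 \<partial>two_level M) = M\<^sup>2"
    using * by (subst integral_eq_nn_integral) auto
qed

text \<open>The sign detector \<open>z \<mapsto> M sgn z\<close> errs by \<open>2M\<close>, on an event of probability at most
  \<open>exp (- M\<^sup>2 / 2)\<close>.\<close>

lemma mmse_two_level_le:
  assumes M: "0 < M"
  shows "mmse (two_level M) \<le> 2 * M\<^sup>2 * exp (- M\<^sup>2 / 2)"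
proof -
  define g where "g z = (if 0 \<le> z then M else - M)" for z :: real
  interpret real_distribution "two_level M"
    using two_level_in_P2(1)[OF M] by (rule P2_real_distribution)
  \<comment> \<open>The cross term 2 M |z| is nonnegative, so (|z| + M)^2 \<ge> z^2 + M^2.\<close>
  have tail: "\<phi> (\<bar>z\<bar> + M) \<le> exp (- M\<^sup>2 / 2) * \<phi> z" for z
  proof -
    have "0 \<le> M * \<bar>z\<bar>" using M by simp
    then have "- (\<bar>z\<bar> + M)\<^sup>2 / 2 \<le> - M\<^sup>2 / 2 + - z\<^sup>2 / 2"
      by (simp add: power2_sum)
    then have "exp (- (\<bar>z\<bar> + M)\<^sup>2 / 2) \<le> exp (- M\<^sup>2 / 2) * exp (- z\<^sup>2 / 2)"
      unfolding exp_add[symmetric] by (simp only: exp_le_cancel_iff)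
    then show ?thesis
      by (simp add: std_normal_density_def divide_right_mono)
  qed
  have "ennreal (mmse (two_level M)) \<le>
      (\<integral>\<^sup>+z. \<integral>\<^sup>+y. ennreal ((y - g z)\<^sup>2 * \<phi> (z - y)) \<partial>two_level M \<partial>lborel)"
    by (rule mmse_le_estimator[OF two_level_in_P2(1)[OF M]])
  also have "\<dots> \<le> (\<integral>\<^sup>+z. ennreal (2 * M\<^sup>2 * exp (- M\<^sup>2 / 2) * \<phi> z) \<partial>lborel)"
  proof (rule nn_integral_mono)
    fix z
    have "(\<integral>\<^sup>+y. ennreal ((y - g z)\<^sup>2 * \<phi> (z - y)) \<partial>two_level M) =
        (ennreal ((- M - g z)\<^sup>2 * \<phi> (z + M)) + ennreal ((M - g z)\<^sup>2 * \<phi> (z - M))) / 2"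
      by (subst nn_integral_two_level[OF M]) auto
    also have "\<dots> = ennreal (((- M - g z)\<^sup>2 * \<phi> (z + M) + (M - g z)\<^sup>2 * \<phi> (z - M)) / 2)"
      by (simp add: divide_ennreal flip: ennreal_plus ennreal_numeral)
    \<comment> \<open>Only the level of the wrong sign contributes: its squared error is (2M)^2, its
      weight 1/2, and its distance from z is |z| + M.\<close>
    also have "((- M - g z)\<^sup>2 * \<phi> (z + M) + (M - g z)\<^sup>2 * \<phi> (z - M)) / 2 = 2 * M\<^sup>2 * \<phi> (\<bar>z\<bar> + M)"
    proof -
      have sym: "\<phi> (- x) = \<phi> x" for x by (simp add: std_normal_density_def)
      show ?thesis
        using sym[of "z - M"] by (cases "0 \<le> z") (auto simp: g_def power2_eq_square algebra_simps)
    qed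
    also have "ennreal \<dots> \<le> ennreal (2 * M\<^sup>2 * exp (- M\<^sup>2 / 2) * \<phi> z)"
      using mult_left_mono[OF tail[of z], of "2 * M\<^sup>2"] by (intro ennreal_leI) (simp add: mult.assoc)
    finally show "(\<integral>\<^sup>+y. ennreal ((y - g z)\<^sup>2 * \<phi> (z - y)) \<partial>two_level M) \<le>
        ennreal (2 * M\<^sup>2 * exp (- M\<^sup>2 / 2) * \<phi> z)" .
  qed
  also have "\<dots> = ennreal (\<integral>z. 2 * M\<^sup>2 * exp (- M\<^sup>2 / 2) * \<phi> z \<partial>lborel)"
    by (intro nn_integral_eq_integral) auto
  also have "(\<integral>z. 2 * M\<^sup>2 * exp (- M\<^sup>2 / 2) * \<phi> z \<partial>lborel) = 2 * M\<^sup>2 * exp (- M\<^sup>2 / 2)"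
    by simp
  finally show ?thesis by (simp add: ennreal_le_iff)
qed

text \<open>With L = ln (1/k) one has M^2 = 16 L, so the detection error carries exp(-M^2/2) = k^8,
  well below the k^2 that suffices. Transport and error contribute 32 L k^2 each, hence 64. The
  restriction k \<le> 1/e gives L \<ge> 1, which absorbs the fixed term 2 \<sigma>^2.\<close>

lemma cost_two_level_le:
  assumes \<sigma>: "0 < \<sigma>" and k: "0 < k" "k \<le> exp (- 1)"
  shows "cost (gaussian \<sigma>) k (two_level (4 * sqrt (ln (1 / k)))) \<le> (2 * \<sigma>\<^sup>2 + 64) * (k\<^sup>2 * ln (1 / k))"
proof -
  define L where "L = ln (1 / k)"
  have "ln k \<le> ln (exp (- 1))" using k by (subst ln_le_cancel_iff) auto
  then have L: "1 \<le> L" using k by (simp add: L_def ln_div)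
  define M where "M = 4 * sqrt L"
  have M: "0 < M" "M\<^sup>2 = 16 * L" using L by (simp_all add: M_def power_mult_distrib)
  have "exp (- M\<^sup>2 / 2) = exp (- L) ^ 8" by (simp add: M(2) flip: exp_of_nat_mult)
  also have "exp (- L) = k" using k by (simp add: L_def ln_div)
  also have "k ^ 8 \<le> k\<^sup>2" using k order_trans[OF k(2), of 1] by (intro power_decreasing) auto
  finally have e: "exp (- M\<^sup>2 / 2) \<le> k\<^sup>2" .
  have "mmse (two_level M) \<le> 2 * M\<^sup>2 * exp (- M\<^sup>2 / 2)" by (rule mmse_two_level_le[OF M(1)])
  also have "\<dots> \<le> 2 * M\<^sup>2 * k\<^sup>2"
    using e by (intro mult_left_mono) auto
  also have "\<dots> = 32 * L * k\<^sup>2" by (simp add: M(2))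
  finally have 1: "mmse (two_level M) \<le> 32 * L * k\<^sup>2" .
  have "k\<^sup>2 * W2_sq (gaussian \<sigma>) (two_level M) \<le> k\<^sup>2 * (2 * \<sigma>\<^sup>2 + 32 * L)"
    using W2_sq_le_second_moments[OF gaussian_in_P2[OF \<sigma>] two_level_in_P2(1)[OF M(1)]]
    by (intro mult_left_mono) (simp_all add: integral_gaussian_square[OF \<sigma>] two_level_in_P2(2)[OF M(1)] M(2))
  also have "\<dots> \<le> k\<^sup>2 * (2 * \<sigma>\<^sup>2 * L + 32 * L)"
    using L mult_left_mono[OF L, of "2 * \<sigma>\<^sup>2"] by (intro mult_left_mono) auto
  finally have "cost (gaussian \<sigma>) k (two_level M) \<le> (2 * \<sigma>\<^sup>2 + 64) * (k\<^sup>2 * L)"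
    using 1 by (simp add: cost_def algebra_simps)
  then show ?thesis by (simp add: M_def L_def)
qed

section \<open>The asymptotic statements\<close>

theorem proposition5p4:
  fixes \<sigma> :: real and P :: "real measure" and J :: "real \<Rightarrow> real"
  assumes "\<sigma> > 0"
  defines "P \<equiv> gaussian \<sigma>"
  defines "J \<equiv> J_star P"
  shows
    "(\<forall>k>0. \<exists>Q. is_arg_min (cost P k) (\<lambda>Q. Q \<in> P2) Q)
   \<and> \<comment> \<open>part (a)\<close>
     mono_on {0<..} J
   \<and> (J \<longlongrightarrow> mmse P) at_top
   \<and> mmse P = \<sigma>\<^sup>2 / (1 + \<sigma>\<^sup>2)
   \<and> (\<forall>Q :: real \<Rightarrow> real measure.
        (\<forall>k>0. is_arg_min (cost P k) (\<lambda>Q. Q \<in> P2) (Q k)) \<longrightarrow>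
          (\<lambda>k. W2_sq P (Q k)) \<in> O[at_top](\<lambda>k. 1 / k\<^sup>2)
        \<and> ((\<lambda>k. W2 P (Q k)) \<longlongrightarrow> 0) at_top
        \<and> ((\<lambda>k. \<integral>\<^sup>+x. ennreal ((controller P (Q k) x - x)\<^sup>2) \<partial>P) \<longlongrightarrow> 0) at_top)
   \<and> (\<exists>\<tau> :: real \<Rightarrow> real.
        (\<forall>k>0. k\<^sup>2 > 1/4 \<longrightarrow> \<tau> k > 0 \<and>
           (\<forall>Q. is_arg_min (cost P k) (\<lambda>Q. Q \<in> gaussian ` {0<..}) Q \<longleftrightarrow> Q = gaussian (\<tau> k)))
        \<and> (\<lambda>k. \<sigma> - \<tau> k) \<in> O[at_top](\<lambda>k. 1 / k\<^sup>2))
   \<and> (\<lambda>k. mmse P - J k) \<in> \<Theta>[at_top](\<lambda>k. 1 / k\<^sup>2)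
   \<and> \<comment> \<open>part (b)\<close>
     (J \<longlongrightarrow> 0) (at_right 0)
   \<and> J \<in> O[at_right 0](\<lambda>k. k\<^sup>2 * ln (1 / k))
   \<and> filterlim (\<lambda>k. 4 * sqrt (ln (1 / k))) at_top (at_right 0)
   \<and> (\<lambda>k. cost P k (two_level (4 * sqrt (ln (1 / k))))) \<in> O[at_right 0](\<lambda>k. k\<^sup>2 * ln (1 / k))"
proof -
  note \<sigma> = assms(1)
  have P: "P \<in> P2" using \<sigma> by (simp add: P_def gaussian_in_P2)
  have lim0: "((\<lambda>k::real. c / k\<^sup>2) \<longlongrightarrow> 0) at_top" for c :: real
    by real_asymp
  obtain C where C: "\<And>k. 1 \<le> k \<Longrightarrow> mmse P - J k \<le> C / k\<^sup>2"
    using mmse_minus_J_star_upper[OF \<sigma>] unfolding P_def J_def by blast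
  obtain a k0 where a: "0 < a" "\<And>k. k0 \<le> k \<Longrightarrow> 0 < k \<Longrightarrow> a / k\<^sup>2 \<le> mmse P - J k"
    using mmse_minus_J_star_lower[OF \<sigma>] unfolding P_def J_def by blast
  have J_le: "J k \<le> mmse P" for k
    using J_star_gaussian_le_mmse[OF \<sigma>] by (simp add: J_def P_def)
  have J0: "0 \<le> J k" for k using J_star_nonneg[OF P] by (simp add: J_def)

  have 1: "\<forall>k>0. \<exists>Q. is_arg_min (cost P k) (\<lambda>Q. Q \<in> P2) Q"
    using cost_minimizer_exists[OF P] by blast
  have 2: "mono_on {0<..} J"
    unfolding J_def by (intro mono_onI J_star_mono P) auto
  have 3: "(J \<longlongrightarrow> mmse P) at_top"
  proof (rule tendsto_sandwich)
    show "\<forall>\<^sub>F k in at_top. mmse P - C / k\<^sup>2 \<le> J k"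
      using eventually_ge_at_top[of 1]
    proof eventually_elim
      case (elim k) with C[of k] show ?case by simp
    qed
    show "\<forall>\<^sub>F k in at_top. J k \<le> mmse P" using J_le by simp
    show "((\<lambda>k. mmse P - C / k\<^sup>2) \<longlongrightarrow> mmse P) at_top"
      using tendsto_diff[OF tendsto_const lim0, of "mmse P" C] by simp
  qed simp
  have 4: "mmse P = \<sigma>\<^sup>2 / (1 + \<sigma>\<^sup>2)"
    unfolding P_def by (rule mmse_gaussian[OF \<sigma>])
  have 5: "(\<lambda>k. W2_sq P (Q k)) \<in> O[at_top](\<lambda>k. 1 / k\<^sup>2)
      \<and> ((\<lambda>k. W2 P (Q k)) \<longlongrightarrow> 0) at_top
      \<and> ((\<lambda>k. \<integral>\<^sup>+x. ennreal ((controller P (Q k) x - x)\<^sup>2) \<partial>P) \<longlongrightarrow> 0) at_top"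
    if Q: "\<forall>k>0. is_arg_min (cost P k) (\<lambda>Q. Q \<in> P2) (Q k)" for Q
  proof -
    have Q2: "Q k \<in> P2" if "0 < k" for k using Q that by (auto simp: is_arg_min_def)
    have W: "0 \<le> W2_sq P (Q k)" "W2_sq P (Q k) \<le> mmse P / k\<^sup>2" if "0 < k" for k
      using W2_sq_nonneg[OF P Q2[OF that]] W2_sq_minimizer_le[OF \<sigma> that] Q that by (auto simp: P_def)
    have "(\<lambda>k. W2_sq P (Q k)) \<in> O[at_top](\<lambda>k. 1 / k\<^sup>2)"
    proof (rule bigoI)
      show "\<forall>\<^sub>F k in at_top. norm (W2_sq P (Q k)) \<le> mmse P * norm (1 / k\<^sup>2)"
        using eventually_gt_at_top[of 0] by eventually_elim (use W in simp)
    qed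
    moreover have lim: "((\<lambda>k. W2_sq P (Q k)) \<longlongrightarrow> 0) at_top"
    proof (rule tendsto_sandwich[OF _ _ tendsto_const lim0])
      show "\<forall>\<^sub>F k in at_top. 0 \<le> W2_sq P (Q k)" "\<forall>\<^sub>F k in at_top. W2_sq P (Q k) \<le> mmse P / k\<^sup>2"
        using eventually_gt_at_top[of 0] by (eventually_elim, use W in simp)+
    qed
    moreover have "((\<lambda>k. W2 P (Q k)) \<longlongrightarrow> 0) at_top"
      using tendsto_real_sqrt[OF lim] by (simp add: W2_def)
    \<comment> \<open>The integral equals the squared transport distance exactly, for every k > 0,
      so the limit just shown carries over.\<close>
    moreover have "((\<lambda>k. \<integral>\<^sup>+x. ennreal ((controller P (Q k) x - x)\<^sup>2) \<partial>P) \<longlongrightarrow> 0) at_top"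
    proof (rule Lim_transform_eventually)
      show "((\<lambda>k. ennreal (W2_sq P (Q k))) \<longlongrightarrow> 0) at_top"
        using tendsto_ennrealI[OF lim] by simp
      show "\<forall>\<^sub>F k in at_top. ennreal (W2_sq P (Q k)) = (\<integral>\<^sup>+x. ennreal ((controller P (Q k) x - x)\<^sup>2) \<partial>P)"
        using eventually_gt_at_top[of 0]
        by eventually_elim (simp add: P_def nn_integral_controller[OF \<sigma> Q2])
    qed
    ultimately show ?thesis by blast
  qed
  have 6: "\<exists>\<tau> :: real \<Rightarrow> real.
      (\<forall>k>0. k\<^sup>2 > 1/4 \<longrightarrow> \<tau> k > 0 \<and>
         (\<forall>Q. is_arg_min (cost P k) (\<lambda>Q. Q \<in> gaussian ` {0<..}) Q \<longleftrightarrow> Q = gaussian (\<tau> k)))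
      \<and> (\<lambda>k. \<sigma> - \<tau> k) \<in> O[at_top](\<lambda>k. 1 / k\<^sup>2)"
  proof -
    obtain \<tau> :: "real \<Rightarrow> real" where \<tau>: "\<And>k. 0 < k \<Longrightarrow> 0 < \<tau> k"
      "\<And>k Q. 0 < k \<Longrightarrow> 1/4 < k\<^sup>2 \<Longrightarrow>
        is_arg_min (cost P k) (\<lambda>Q. Q \<in> gaussian ` {0<..}) Q \<longleftrightarrow> Q = gaussian (\<tau> k)"
      "\<And>k. 0 < k \<Longrightarrow> \<bar>\<sigma> - \<tau> k\<bar> \<le> 1 / k\<^sup>2"
      using gaussian_class_minimizers[OF \<sigma>] unfolding P_def by blast
    have "(\<lambda>k. \<sigma> - \<tau> k) \<in> O[at_top](\<lambda>k. 1 / k\<^sup>2)"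
    proof (rule bigoI)
      show "\<forall>\<^sub>F k in at_top. norm (\<sigma> - \<tau> k) \<le> 1 * norm (1 / k\<^sup>2)"
        using eventually_gt_at_top[of 0] by eventually_elim (use \<tau>(3) in simp)
    qed
    with \<tau>(1,2) show ?thesis by blast
  qed
  have 7: "(\<lambda>k. mmse P - J k) \<in> \<Theta>[at_top](\<lambda>k. 1 / k\<^sup>2)"
  proof (rule bigthetaI)
    show "(\<lambda>k. mmse P - J k) \<in> O[at_top](\<lambda>k. 1 / k\<^sup>2)"
    proof (rule bigoI)
      show "\<forall>\<^sub>F k in at_top. norm (mmse P - J k) \<le> C * norm (1 / k\<^sup>2)"
        using eventually_ge_at_top[of 1] by eventually_elim (use C J_le in simp)
    qed
    show "(\<lambda>k. mmse P - J k) \<in> \<Omega>[at_top](\<lambda>k. 1 / k\<^sup>2)"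
    proof (rule landau_omega.bigI[OF a(1)])
      show "\<forall>\<^sub>F k in at_top. a * norm (1 / k\<^sup>2) \<le> norm (mmse P - J k)"
        using eventually_ge_at_top[of k0] eventually_gt_at_top[of 0]
      proof eventually_elim
        case (elim k) with a(2)[of k] J_le[of k] show ?case by simp
      qed
    qed
  qed
  \<comment> \<open>The range in which the two-level estimate holds; there ln (1/k) is positive, so
    both the level M and the comparison function have the right sign.\<close>
  have small: "\<forall>\<^sub>F k :: real in at_right 0. 0 < k \<and> k \<le> exp (- 1)"
    by (auto simp: eventually_at_right_field intro!: exI[of _ "exp (- 1) :: real"])
  have two: "\<forall>\<^sub>F k in at_right 0. 0 \<le> cost P k (two_level (4 * sqrt (ln (1 / k)))) \<and>
      J k \<le> cost P k (two_level (4 * sqrt (ln (1 / k)))) \<and>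
      cost P k (two_level (4 * sqrt (ln (1 / k)))) \<le> (2 * \<sigma>\<^sup>2 + 64) * (k\<^sup>2 * ln (1 / k)) \<and>
      0 \<le> k\<^sup>2 * ln (1 / k)"
    using small
  proof eventually_elim
    case (elim k)
    then have "k < 1" by (auto intro: le_less_trans[of k "exp (- 1)"])
    then have l: "0 < ln (1 / k)" using elim by (simp add: ln_div)
    then have "two_level (4 * sqrt (ln (1 / k))) \<in> P2"
      by (intro two_level_in_P2) simp
    then show ?case
      using cost_nonneg[OF P] J_star_le_cost[OF P] cost_two_level_le[OF \<sigma>] elim l
      by (auto simp: J_def P_def)
  qed
  have 10: "(\<lambda>k. cost P k (two_level (4 * sqrt (ln (1 / k))))) \<in> O[at_right 0](\<lambda>k. k\<^sup>2 * ln (1 / k))"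
  proof (rule bigoI)
    show "\<forall>\<^sub>F k in at_right 0. norm (cost P k (two_level (4 * sqrt (ln (1 / k))))) \<le> (2 * \<sigma>\<^sup>2 + 64) * norm (k\<^sup>2 * ln (1 / k))"
      using two by eventually_elim simp
  qed
  have 9: "J \<in> O[at_right 0](\<lambda>k. k\<^sup>2 * ln (1 / k))"
  proof (rule bigoI)
    show "\<forall>\<^sub>F k in at_right 0. norm (J k) \<le> (2 * \<sigma>\<^sup>2 + 64) * norm (k\<^sup>2 * ln (1 / k))"
      using two by eventually_elim (use J0 in simp)
  qed
  have 8: "(J \<longlongrightarrow> 0) (at_right 0)"
  proof (rule tendsto_sandwich[OF _ _ tendsto_const])
    show "\<forall>\<^sub>F k in at_right 0. 0 \<le> J k" using J0 by simp
    show "\<forall>\<^sub>F k in at_right 0. J k \<le> (2 * \<sigma>\<^sup>2 + 64) * (k\<^sup>2 * ln (1 / k))"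
      using two by eventually_elim simp
    show "((\<lambda>k. (2 * \<sigma>\<^sup>2 + 64) * (k\<^sup>2 * ln (1 / k))) \<longlongrightarrow> 0) (at_right 0)"
      by real_asymp
  qed
  have 11: "filterlim (\<lambda>k::real. 4 * sqrt (ln (1 / k))) at_top (at_right 0)"
    by real_asymp
  show ?thesis
    using 1 2 3 4 5 6 7 8 9 10 11 by blast
qed

end
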